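(* Let $X_t:[0,\infty)\to\mathcal K$ be a sticky Lagrangian solution with data $\bar X\in\mathcal K$, $\bar V\in L^2(\Omega)$. Let $V_t=\frac{d^+}{dt}X_t$, $\rho_t=X_{t\#}\mathfrak m$, $\Psi_t=V_t+\Phi*\rho_t(X_t)$. Then $$V_t\in\mathcal H_{X_t},\ \text{and so also}\ \Psi_t\in\mathcal H_{X_t},\quad\text{for all }t\ge0.$$ Furthermore, for $0\le s\le t$, $$\Psi_s-\Psi_t\in\partial I_{\mathcal K}(X_t),\quad\text{and hence}\quad\Psi_t=\mathrm P_{\mathcal H_{X_t}}\Psi_s,$$ $$X_t=\mathrm P_{\mathcal K}\left(X_s+(t-s)\Psi_s-\int_s^t\Phi*\rho_r(X_r)\,dr\right).$$ In particular, for all $t\ge0$, $$V_t=\mathrm P_{\mathcal H_{X_t}}U[X_t]=\mathrm P_{\mathcal H_{X_t}}\bar\Psi-\Phi*\rho_t(X_t),\ \text{and so also}\ \Psi_t=\mathrm P_{\mathcal H_{X_t}}\bar\Psi,$$ $$X_t=\mathrm P_{\mathcal K}\left(\bar X+\int_0^tU[X_s]\,ds\right)=\mathrm P_{\mathcal K}\left(\bar X+t\bar\Psi-\int_0^t\Phi*\rho_s(X_s)\,ds\right).$$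
   Context: The communication protocol $\phi$ on $\mathbb R$ is nonnegative, symmetric, radially nonincreasing and locally integrable; $\Phi(x)=\int_0^x\phi(y)dy$. $\Omega=(0,1)$, $\mathfrak m$ is Lebesgue measure on $\Omega$. $\mathcal K\subset L^2(\Omega)$ is the closed convex cone of nondecreasing right-continuous functions; for $X\in\mathcal K$, $\partial I_{\mathcal K}(X)=\{W\in L^2(\Omega):\langle W,Y-X\rangle\le0\ \forall Y\in\mathcal K\}$ (subdifferential of the indicator function of $\mathcal K$). $\Omega_X=\{m\in\Omega: X\text{ is constant in a neighborhood of }m\}$, and $\mathcal H_X=\{U\in L^2(\Omega): U\text{ is constant on each interval contained in }\Omega_X\}$. $\mathrm P_{\mathcal C}$ is the metric projection in $L^2(\Omega)$ onto a closed convex set $\mathcal C$. If $X\in\mathcal K$ and $\rho=X_\#\mathfrak m$, then $\Phi*\rho(X)=\int_\Omega\Phi(X-X(\omega))d\omega$, and $\Psi[X,V]=V+\Phi*\rho(X)$. Given data $\bar X\in\mathcal K$, $\bar V\in L^2(\Omega)$, put $\bar\Psi=\Psi[\bar X,\bar V]$ and $U[X]=\bar\Psi-\int_\Omega\Phi(X-X(\omega))d\omega$. Lagrangian solution with data $(\bar X,\bar V)$: the unique absolutely continuous curve $X_t:[0,\infty)\to\mathcal K$ with $X_0=\bar X$ and $-\dot X_t\in-U[X_t]+\partial I_{\mathcal K}(X_t)$ for a.e. $t>0$; its right-derivative $V_t=\frac{d^+}{dt}X_t$ exists for all $t\ge0$. A Lagrangian solution is sticky if $\Omega_{X_s}\subset\Omega_{X_t}$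 for all $s\le t$. *)

theory Defs
  imports "HOL-Analysis.Analysis"
begin

section \<open>The Hilbert space of square-integrable functions on the unit interval\<close>

definition Omega :: "real set"
  where "Omega = {0<..<1}"

definition mOmega :: "real measure"
  where "mOmega = restrict_space lborel Omega"

definition sq_integrable :: "(real \<Rightarrow> real) \<Rightarrow> bool"
  where "sq_integrable f \<longleftrightarrow> f \<in> borel_measurable mOmega \<and> integrable mOmega (\<lambda>m. (f m)\<^sup>2)"

lemma sq_integrable_mult:
  assumes "sq_integrable f" "sq_integrable g"
  shows "integrable mOmega (\<lambda>m. f m * g m)"
proof (rule Bochner_Integration.integrable_bound)
  show "integrable mOmega (\<lambda>m. (f m)\<^sup>2 + (g m)\<^sup>2)"
    using assms by (auto simp: sq_integrable_def)
  show "(\<lambda>m. f m * g m) \<in> borel_measurable mOmega"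
    using assms by (auto simp: sq_integrable_def)
  have "norm (a * b) \<le> norm (a\<^sup>2 + b\<^sup>2)" for a b :: real
  proof -
    have "0 \<le> (\<bar>a\<bar> - \<bar>b\<bar>)\<^sup>2" by simp
    then have "2 * (\<bar>a\<bar> * \<bar>b\<bar>) \<le> a\<^sup>2 + b\<^sup>2"
      by (simp add: power2_diff)
    moreover have "0 \<le> \<bar>a\<bar> * \<bar>b\<bar>" by simp
    ultimately have "\<bar>a\<bar> * \<bar>b\<bar> \<le> a\<^sup>2 + b\<^sup>2" by linarith
    then show ?thesis by (simp add: abs_mult)
  qed
  then show "AE m in mOmega. norm (f m * g m) \<le> norm ((f m)\<^sup>2 + (g m)\<^sup>2)"
    by simp
qed

lemma sq_integrable_zero: "sq_integrable (\<lambda>_. 0)"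
  by (simp add: sq_integrable_def)

lemma sq_integrable_add:
  assumes "sq_integrable f" "sq_integrable g"
  shows "sq_integrable (\<lambda>m. f m + g m)"
  using assms sq_integrable_mult[OF assms]
  by (auto simp: sq_integrable_def power2_sum mult.assoc)

lemma sq_integrable_scale:
  assumes "sq_integrable f"
  shows "sq_integrable (\<lambda>m. c * f m)"
  using assms by (auto simp: sq_integrable_def power_mult_distrib)

lemma sq_integrable_uminus:
  assumes "sq_integrable f"
  shows "sq_integrable (\<lambda>m. - f m)"
  using assms by (auto simp: sq_integrable_def)

definition l2_eq :: "(real \<Rightarrow> real) \<Rightarrow> (real \<Rightarrow> real) \<Rightarrow> bool"
  where "l2_eq f g \<longleftrightarrow> sq_integrable f \<and> sq_integrable g \<and> (AE m in mOmega. f m = g m)"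

quotient_type l2 = "real \<Rightarrow> real" / partial: l2_eq
proof (rule part_equivpI)
  show "\<exists>f. l2_eq f f"
    by (auto simp: l2_eq_def intro!: exI[of _ "\<lambda>_. 0"] sq_integrable_zero)
  show "symp l2_eq"
    by (auto simp: symp_def l2_eq_def)
  show "transp l2_eq"
    by (auto simp: transp_def l2_eq_def)
qed

instantiation l2 :: real_inner
begin

lift_definition zero_l2 :: l2 is "\<lambda>_. 0"
  by (simp add: l2_eq_def sq_integrable_zero)

lift_definition plus_l2 :: "l2 \<Rightarrow> l2 \<Rightarrow> l2" is "\<lambda>f g m. f m + g m"
  by (auto simp: l2_eq_def intro!: sq_integrable_add)

lift_definition uminus_l2 :: "l2 \<Rightarrow> l2" is "\<lambda>f m. - f m"
  by (auto simp: l2_eq_def intro!: sq_integrable_uminus)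

definition minus_l2 :: "l2 \<Rightarrow> l2 \<Rightarrow> l2"
  where "minus_l2 U W = U + - W"

lift_definition scaleR_l2 :: "real \<Rightarrow> l2 \<Rightarrow> l2" is "\<lambda>c f m. c * f m"
  by (auto simp: l2_eq_def intro!: sq_integrable_scale)

lift_definition inner_l2 :: "l2 \<Rightarrow> l2 \<Rightarrow> real" is "\<lambda>f g. \<integral>m. f m * g m \<partial>mOmega"
  by (rule integral_cong_AE) (auto simp: l2_eq_def sq_integrable_def)

definition norm_l2 :: "l2 \<Rightarrow> real"
  where "norm_l2 U = sqrt (inner U U)"

definition sgn_l2 :: "l2 \<Rightarrow> l2"
  where "sgn_l2 U = inverse (norm U) *\<^sub>R U"

definition dist_l2 :: "l2 \<Rightarrow> l2 \<Rightarrow> real"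
  where "dist_l2 U W = norm (U - W)"

definition uniformity_l2 :: "(l2 \<times> l2) filter"
  where "uniformity_l2 = (INF e\<in>{0<..}. principal {(U, W). dist U W < e})"

definition open_l2 :: "l2 set \<Rightarrow> bool"
  where "open_l2 A \<longleftrightarrow> (\<forall>U\<in>A. \<forall>\<^sub>F (U', W) in uniformity. U' = U \<longrightarrow> W \<in> A)"

instance
proof
  fix U V W :: l2 and a b :: real
  show "U + V + W = U + (V + W)"
    by transfer (auto simp: l2_eq_def intro!: sq_integrable_add AE_I2)
  show "U + V = V + U"
    by transfer (auto simp: l2_eq_def intro!: sq_integrable_add AE_I2)
  show "0 + U = U"
    by transfer (auto simp: l2_eq_def)
  show "- U + U = 0"
    by transfer (auto simp: l2_eq_def sq_integrable_zero)
  show "U - V = U + - V"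
    by (rule minus_l2_def)
  show "a *\<^sub>R (U + V) = a *\<^sub>R U + a *\<^sub>R V"
    by transfer (auto simp: l2_eq_def distrib_left intro!: sq_integrable_add sq_integrable_scale)
  show "(a + b) *\<^sub>R U = a *\<^sub>R U + b *\<^sub>R U"
    by transfer (auto simp: l2_eq_def distrib_right intro!: sq_integrable_add sq_integrable_scale)
  show "a *\<^sub>R b *\<^sub>R U = (a * b) *\<^sub>R U"
    by transfer (auto simp: l2_eq_def mult.assoc intro!: sq_integrable_scale)
  show "1 *\<^sub>R U = U"
    by transfer (auto simp: l2_eq_def)
  show "dist U V = norm (U - V)"
    by (rule dist_l2_def)
  show "sgn U = inverse (norm U) *\<^sub>R U"
    by (rule sgn_l2_def)
  show "uniformity = (INF e\<in>{0<..}. principal {(x, y::l2). dist x y < e})"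
    by (rule uniformity_l2_def)
  show "open A \<longleftrightarrow> (\<forall>x\<in>A. \<forall>\<^sub>F (x', y) in uniformity. x' = x \<longrightarrow> y \<in> A)" for A :: "l2 set"
    by (rule open_l2_def)
  show "norm U = sqrt (inner U U)"
    by (rule norm_l2_def)
  show "inner U V = inner V U"
    by transfer (simp add: mult.commute)
  show "inner (U + V) W = inner U W + inner V W"
    by transfer (auto simp: distrib_right l2_eq_def intro!: Bochner_Integration.integral_add sq_integrable_mult)
  show "inner (a *\<^sub>R U) V = a * inner U V"
    by transfer (simp add: mult.assoc)
  show "0 \<le> inner U U"
    by transfer simp
  show "inner U U = 0 \<longleftrightarrow> U = 0"
  proof transfer
    fix f assume "l2_eq f f"
    then have "integrable mOmega (\<lambda>m. f m * f m)" "sq_integrable f"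
      by (auto simp: l2_eq_def intro: sq_integrable_mult)
    then show "(\<integral>m. f m * f m \<partial>mOmega) = 0 \<longleftrightarrow> l2_eq f (\<lambda>_. 0)"
      by (subst integral_nonneg_eq_0_iff_AE) (auto simp: l2_eq_def sq_integrable_zero)
  qed
qed

end

lemma sq_integrable_rep: "sq_integrable (rep_l2 U)"
  using Quotient3_rep_reflp[OF Quotient3_l2, of U] by (simp add: l2_eq_def)

lemma abs_rep_l2: "abs_l2 (rep_l2 U) = U"
  by (rule Quotient3_abs_rep[OF Quotient3_l2])

lemma finite_measure_mOmega: "finite_measure mOmega" "measure mOmega (space mOmega) = 1"
proof -
  have "emeasure mOmega (space mOmega) = 1"
    by (simp add: mOmega_def Omega_def space_restrict_space emeasure_restrict_space)
  then show "finite_measure mOmega" "measure mOmega (space mOmega) = 1"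
    by (auto intro!: finite_measureI simp: measure_def)
qed

lemma inner_abs_l2:
  assumes "sq_integrable f" "sq_integrable g"
  shows "inner (abs_l2 f) (abs_l2 g) = (\<integral>m. f m * g m \<partial>mOmega)"
  using assms by (intro inner_l2.abs_eq) (auto simp: l2_eq_def)

lemma dist_abs_l2:
  assumes "sq_integrable f" "sq_integrable g"
  shows "(dist (abs_l2 f) (abs_l2 g))\<^sup>2 = (\<integral>m. (f m - g m)\<^sup>2 \<partial>mOmega)"
proof -
  have "abs_l2 f - abs_l2 g = abs_l2 (\<lambda>m. f m + - g m)"
    using assms by (simp add: minus_l2_def plus_l2.abs_eq uminus_l2.abs_eq l2_eq_def sq_integrable_uminus)
  moreover have "sq_integrable (\<lambda>m. f m + - g m)"
    using assms by (intro sq_integrable_add sq_integrable_uminus)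
  ultimately show ?thesis
    by (simp add: dist_norm power2_norm_eq_inner inner_abs_l2 flip: power2_eq_square)
qed

instance l2 :: complete_space
proof
  fix X :: "nat \<Rightarrow> l2" assume X: "Cauchy X"
  define f where "f n = rep_l2 (X n)" for n
  have sf: "sq_integrable (f n)" and Xf: "abs_l2 (f n) = X n" for n
    by (auto simp: f_def sq_integrable_rep abs_rep_l2)
  have [measurable]: "f n \<in> borel_measurable mOmega" for n
    using sf by (auto simp: sq_integrable_def)
  interpret finite_measure mOmega by (rule finite_measure_mOmega)
  have s1: "sq_integrable (\<lambda>_. 1)"
    by (simp add: sq_integrable_def)
  have sd: "sq_integrable (\<lambda>m. \<bar>f i m - f j m\<bar>)" for i j
    using sq_integrable_add[OF sf[of i] sq_integrable_uminus[OF sf[of j]]]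
    by (simp add: sq_integrable_def)
  have L1: "(\<integral>m. \<bar>f i m - f j m\<bar> \<partial>mOmega) \<le> dist (X i) (X j)" for i j
  proof -
    have "(\<integral>m. \<bar>f i m - f j m\<bar> \<partial>mOmega) = inner (abs_l2 (\<lambda>m. \<bar>f i m - f j m\<bar>)) (abs_l2 (\<lambda>_. 1))"
      by (simp add: inner_abs_l2 sd s1)
    also have "\<dots> \<le> norm (abs_l2 (\<lambda>m. \<bar>f i m - f j m\<bar>)) * norm (abs_l2 (\<lambda>_. 1))"
      by (rule norm_cauchy_schwarz)
    also have "norm (abs_l2 (\<lambda>_. 1)) = 1"
      by (simp add: norm_eq_sqrt_inner inner_abs_l2 s1 finite_measure_mOmega)
    also have "norm (abs_l2 (\<lambda>m. \<bar>f i m - f j m\<bar>)) = dist (X i) (X j)"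
    proof (rule power2_eq_imp_eq)
      show "(norm (abs_l2 (\<lambda>m. \<bar>f i m - f j m\<bar>)))\<^sup>2 = (dist (X i) (X j))\<^sup>2"
        using dist_abs_l2[OF sf[of i] sf[of j]]
        by (simp add: Xf power2_norm_eq_inner inner_abs_l2 sd flip: power2_eq_square)
    qed auto
    finally show ?thesis by simp
  qed
  have int1: "integrable mOmega (f n)" for n
    using sq_integrable_mult[OF sf[of n] s1] by simp
  obtain r where r: "strict_mono r" "AE m in mOmega. Cauchy (\<lambda>i. f (r i) m)"
  proof (rule cauchy_L1_AE_cauchy_subseq[of mOmega f])
    fix e :: real assume "e > 0"
    then obtain N where "\<forall>i\<ge>N. \<forall>j\<ge>N. dist (X i) (X j) < e"
      using metric_CauchyD[OF X, of e] by auto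
    then show "\<exists>N. \<forall>i\<ge>N. \<forall>j\<ge>N. (LINT x|mOmega. norm (f i x - f j x)) < e"
      using le_less_trans[OF L1] by (auto intro!: exI[of _ N])
  qed (auto intro: int1)
  define F where "F m = lim (\<lambda>i. f (r i) m)" for m
  have F_meas[measurable]: "F \<in> borel_measurable mOmega"
    unfolding F_def by measurable
  have F_lim: "AE m in mOmega. (\<lambda>i. f (r i) m) \<longlonglongrightarrow> F m"
    using r(2) by eventually_elim (auto simp: F_def Cauchy_convergent_iff convergent_LIMSEQ_iff)
  have key: "sq_integrable F \<and> dist (abs_l2 F) (X j) \<le> e"
    if e: "e > 0" and N: "\<forall>i\<ge>N. \<forall>j\<ge>N. dist (X i) (X j) < e" and j: "j \<ge> N" for e N j
  proof -
    have int: "integrable mOmega (\<lambda>m. (f i m - f j m)\<^sup>2)" for i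
      using sd[of i j] by (simp add: sq_integrable_def)
    have "(\<integral>\<^sup>+m. ennreal ((F m - f j m)\<^sup>2) \<partial>mOmega)
        = (\<integral>\<^sup>+m. liminf (\<lambda>i. ennreal ((f (r i) m - f j m)\<^sup>2)) \<partial>mOmega)"
    proof (rule nn_integral_cong_AE)
      show "AE m in mOmega. ennreal ((F m - f j m)\<^sup>2) = liminf (\<lambda>i. ennreal ((f (r i) m - f j m)\<^sup>2))"
        using F_lim
      proof eventually_elim
        case (elim m)
        then have "(\<lambda>i. ennreal ((f (r i) m - f j m)\<^sup>2)) \<longlonglongrightarrow> ennreal ((F m - f j m)\<^sup>2)"
          by (intro tendsto_intros)
        then show ?case by (rule lim_imp_Liminf[OF sequentially_bot, symmetric])
      qed
    qed
    also have "\<dots> \<le> liminf (\<lambda>i. \<integral>\<^sup>+m. ennreal ((f (r i) m - f j m)\<^sup>2) \<partial>mOmega)"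
      by (rule nn_integral_liminf) measurable
    also have "\<dots> \<le> ennreal (e\<^sup>2)"
    proof (rule Liminf_le)
      show "\<forall>\<^sub>F i in sequentially. (\<integral>\<^sup>+m. ennreal ((f (r i) m - f j m)\<^sup>2) \<partial>mOmega) \<le> ennreal (e\<^sup>2)"
        using eventually_ge_at_top[of N]
      proof eventually_elim
        case (elim i)
        then have "r i \<ge> N"
          using seq_suble[OF r(1), of i] by linarith
        then have "(dist (X (r i)) (X j))\<^sup>2 \<le> e\<^sup>2"
          using N j by (intro power_mono) (auto intro: less_imp_le)
        then show ?case
          using dist_abs_l2[OF sf[of "r i"] sf[of j]] int[of "r i"]
          by (subst nn_integral_eq_integral) (auto simp: Xf intro!: ennreal_leI)
      qed
    qed simp
    finally have le: "(\<integral>\<^sup>+m. ennreal ((F m - f j m)\<^sup>2) \<partial>mOmega) \<le> ennreal (e\<^sup>2)" .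
    have intF: "integrable mOmega (\<lambda>m. (F m - f j m)\<^sup>2)"
      using le by (intro integrableI_nonneg) (auto simp: le_less_trans ennreal_less_top)
    then have "sq_integrable (\<lambda>m. F m - f j m)"
      by (simp add: sq_integrable_def)
    from sq_integrable_add[OF this sf[of j]] have sF: "sq_integrable F"
      by simp
    have "(\<integral>m. (F m - f j m)\<^sup>2 \<partial>mOmega) \<le> e\<^sup>2"
      using le intF by (simp add: nn_integral_eq_integral)
    then have "(dist (abs_l2 F) (X j))\<^sup>2 \<le> e\<^sup>2"
      using dist_abs_l2[OF sF sf[of j]] by (simp add: Xf)
    then show ?thesis
      using sF e by (auto intro: power2_le_imp_le)
  qed
  have "X \<longlonglongrightarrow> abs_l2 F"
  proof (rule metric_LIMSEQ_I)
    fix e :: real assume "e > 0"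
    then obtain N where "\<forall>i\<ge>N. \<forall>j\<ge>N. dist (X i) (X j) < e / 2"
      using metric_CauchyD[OF X, of "e / 2"] by auto
    with key[of "e / 2" N] \<open>e > 0\<close> show "\<exists>no. \<forall>n\<ge>no. dist (X n) (abs_l2 F) < e"
      by (force simp: dist_commute intro!: exI[of _ N])
  qed
  then show "convergent X"
    by (auto simp: convergent_def)
qed

instance l2 :: banach ..

definition metric_proj :: "'a::metric_space set \<Rightarrow> 'a \<Rightarrow> 'a"
  where "metric_proj C x = (THE y. y \<in> C \<and> (\<forall>z\<in>C. dist x y \<le> dist x z))"

section \<open>The cone of nondecreasing functions\<close>

definition nondecr_version :: "l2 \<Rightarrow> (real \<Rightarrow> real) \<Rightarrow> bool"
  where "nondecr_version X f \<longleftrightarrow>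
    sq_integrable f \<and> abs_l2 f = X \<and> mono_on Omega f \<and> (\<forall>m\<in>Omega. continuous (at_right m) f)"

definition K :: "l2 set"
  where "K = {X. \<exists>f. nondecr_version X f}"

text \<open>
  For \<^term>\<open>X \<in> K\<close> the nondecreasing right-continuous version is unique on \<^term>\<open>Omega\<close>;
  \<open>version X\<close> is meaningful only for such \<^term>\<open>X\<close>.
\<close>

definition version :: "l2 \<Rightarrow> real \<Rightarrow> real"
  where "version X = (SOME f. nondecr_version X f)"

definition subdiff_K :: "l2 \<Rightarrow> l2 set"
  where "subdiff_K X = {W. \<forall>Y\<in>K. inner W (Y - X) \<le> 0}"

definition Omega_const :: "l2 \<Rightarrow> real set"
  where "Omega_const X =
    {m \<in> Omega. \<exists>e>0. {m - e<..<m + e} \<subseteq> Omega \<and> version X constant_on {m - e<..<m + e}}"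

text \<open>Elements of \<^typ>\<open>l2\<close> are classes, so constancy on an interval is meant almost everywhere.\<close>

definition H :: "l2 \<Rightarrow> l2 set"
  where "H X = {U. \<forall>I. is_interval I \<and> I \<subseteq> Omega_const X \<longrightarrow>
                    (\<exists>c. AE m in mOmega. m \<in> I \<longrightarrow> rep_l2 U m = c)}"

section \<open>The alignment force\<close>

text \<open>
  A communication protocol may be singular at the origin, e.g.\ \<open>\<bar>x\<bar> powr -a\<close> with \<open>0 < a < 1\<close>.
  The value at \<open>0\<close> is therefore exempt from monotonicity, since otherwise a real-valued protocol
  would have to be bounded.
\<close>

definition comm_protocol :: "(real \<Rightarrow> real) \<Rightarrow> bool"
  where "comm_protocol \<phi> \<longleftrightarrow>
    (\<forall>x. 0 \<le> \<phi> x) \<and> (\<forall>x. \<phi> (- x) = \<phi> x) \<and>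
    (\<forall>x y. 0 < \<bar>x\<bar> \<and> \<bar>x\<bar> \<le> \<bar>y\<bar> \<longrightarrow> \<phi> y \<le> \<phi> x) \<and>
    (\<forall>C. compact C \<longrightarrow> set_integrable lborel C \<phi>)"

definition Phi :: "(real \<Rightarrow> real) \<Rightarrow> real \<Rightarrow> real"
  where "Phi \<phi> x = (LBINT y=0..ereal x. \<phi> y)"

definition law :: "l2 \<Rightarrow> real measure"
  where "law X = distr mOmega borel (version X)"

definition Phi_conv :: "(real \<Rightarrow> real) \<Rightarrow> real measure \<Rightarrow> real \<Rightarrow> real"
  where "Phi_conv \<phi> \<rho> x = (\<integral>y. Phi \<phi> (x - y) \<partial>\<rho>)"

text \<open>The class of \<open>(\<Phi> * \<rho>) \<circ> X\<close>, where \<open>\<rho>\<close> is the law of \<open>X\<close>.\<close>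

definition Phi_rho :: "(real \<Rightarrow> real) \<Rightarrow> l2 \<Rightarrow> l2"
  where "Phi_rho \<phi> X = abs_l2 (\<lambda>m. Phi_conv \<phi> (law X) (version X m))"

definition Psi :: "(real \<Rightarrow> real) \<Rightarrow> l2 \<Rightarrow> l2 \<Rightarrow> l2"
  where "Psi \<phi> X V = V + Phi_rho \<phi> X"

definition U_field :: "(real \<Rightarrow> real) \<Rightarrow> l2 \<Rightarrow> l2 \<Rightarrow> l2 \<Rightarrow> l2"
  where "U_field \<phi> Xbar Vbar X =
    Psi \<phi> Xbar Vbar - abs_l2 (\<lambda>m. \<integral>w. Phi \<phi> (version X m - version X w) \<partial>mOmega)"

section \<open>Lagrangian solutions\<close>

text \<open>Absolute continuity on every bounded interval \<open>[0, T]\<close>.\<close>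

definition abs_cont_curve :: "(real \<Rightarrow> 'a::metric_space) \<Rightarrow> bool"
  where "abs_cont_curve X \<longleftrightarrow>
    (\<forall>T>0. \<forall>\<epsilon>>0. \<exists>\<delta>>0. \<forall>(n::nat) a b.
       (\<forall>i<n. 0 \<le> a i \<and> a i \<le> b i \<and> b i \<le> T) \<and>
       (\<forall>i<n. \<forall>j<n. i \<noteq> j \<longrightarrow> {a i<..<b i} \<inter> {a j<..<b j} = {}) \<and>
       (\<Sum>i<n. b i - a i) < \<delta> \<longrightarrow> (\<Sum>i<n. dist (X (a i)) (X (b i))) < \<epsilon>)"

definition lagrangian_solution :: "(real \<Rightarrow> real) \<Rightarrow> l2 \<Rightarrow> l2 \<Rightarrow> (real \<Rightarrow> l2) \<Rightarrow> bool"
  where "lagrangian_solution \<phi> Xbar Vbar X \<longleftrightarrow>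
    (\<forall>t\<ge>0. X t \<in> K) \<and> abs_cont_curve X \<and> X 0 = Xbar \<and>
    (AE t in lborel. 0 < t \<longrightarrow>
       (\<exists>D. (X has_vector_derivative D) (at t) \<and>
            - D \<in> {- U_field \<phi> Xbar Vbar (X t) + W | W. W \<in> subdiff_K (X t)}))"

definition sticky :: "(real \<Rightarrow> l2) \<Rightarrow> bool"
  where "sticky X \<longleftrightarrow> (\<forall>s t. 0 \<le> s \<and> s \<le> t \<longrightarrow> Omega_const (X s) \<subseteq> Omega_const (X t))"

end

theory Submission
  imports Defs
begin

text \<open>
  Put \<open>P = \<Psi>[Xbar, Vbar]\<close>. An element of \<^term>\<open>subdiff_K X\<close> is
  orthogonal to \<^term>\<open>H X\<close>. Stickiness makes \<open>H (X t)\<close> decrease in time; in particular the velocity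
  \<open>V t\<close>, a limit of difference quotients of \<open>X\<close>, lies in \<open>H (X t)\<close>.
  The differential inclusion says that \<open>P - \<Psi> t \<in> subdiff_K (X t)\<close> for almost every \<open>t\<close>, and a
  continuous function with a right derivative everywhere that is nonnegative almost everywhere has a
  nonnegative right derivative everywhere; tested against fixed elements of \<open>K\<close> and against \<open>X t\<close>
  itself, this gives the inclusion for every \<open>t\<close>. The difference \<open>\<Psi> s - \<Psi> t\<close> is the projection of
  \<open>P - \<Psi> t\<close> onto \<open>H (X s)\<close>, and it stays in the polar of \<open>K\<close> because its pairings with the indicators
  of \<open>{p..<1}\<close> agree with those of \<open>P - \<Psi> t\<close> outside \<open>Omega_const (X s)\<close> and are affine in \<open>p\<close> on each
  component of \<open>Omega_const (X s)\<close>. Since \<open>\<Psi> s - \<Psi> r \<in> subdiff_K (X r)\<close> is orthogonal to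
  \<open>X t \<in> H (X r)\<close> for \<open>s \<le> r \<le> t\<close>, integrating over \<open>r\<close> yields the projection formulas for \<open>X t\<close>.
\<close>

section \<open>Projections and right derivatives\<close>

text \<open>Expanding the square around \<open>y\<close>, the obtuse angle makes
  \<open>(dist x z)\<^sup>2\<close> exceed \<open>(dist x y)\<^sup>2\<close> by at least
  \<open>(dist y z)\<^sup>2\<close>. This yields minimality and also the uniqueness that the
  definite description in \<open>metric_proj\<close> requires.\<close>

lemma metric_proj_eqI:
  fixes x y :: "'a::real_inner"
  assumes "y \<in> C" and obtuse: "\<And>z. z \<in> C \<Longrightarrow> inner (x - y) (z - y) \<le> 0"
  shows "metric_proj C x = y"
proof -
  have split: "(dist x z)\<^sup>2 = (dist x y)\<^sup>2 - 2 * inner (x - y) (z - y) + (dist y z)\<^sup>2" for z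
    by (simp add: dist_norm power2_norm_eq_inner inner_diff_left inner_diff_right inner_commute)
  show ?thesis
    unfolding metric_proj_def
  proof (rule the_equality)
    have "(dist x y)\<^sup>2 \<le> (dist x z)\<^sup>2" if "z \<in> C" for z
      using split[of z] obtuse[OF that] zero_le_power2[of "dist y z"] by linarith
    then show "y \<in> C \<and> (\<forall>z\<in>C. dist x y \<le> dist x z)"
      using \<open>y \<in> C\<close> by (auto intro: power2_le_imp_le)
  next
    fix z assume z: "z \<in> C \<and> (\<forall>w\<in>C. dist x z \<le> dist x w)"
    then have "(dist x z)\<^sup>2 \<le> (dist x y)\<^sup>2"
      using \<open>y \<in> C\<close> by (intro power_mono) auto
    then have "(dist y z)\<^sup>2 \<le> 0"
      using split[of z] obtuse[of z] z by linarith
    then show "z = y" by simp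
  qed
qed

lemma metric_proj_subspaceI:
  fixes x y :: "'a::real_inner"
  assumes "subspace C" "y \<in> C" "\<And>z. z \<in> C \<Longrightarrow> inner (x - y) z = 0"
  shows "metric_proj C x = y"
  using assms by (intro metric_proj_eqI) (auto simp: subspace_diff)

text \<open>A minimising sequence for the distance is Cauchy by the parallelogram law, and its limit
  satisfies the first-order condition of a minimum along every line in \<open>C\<close>.\<close>

lemma orthogonal_projection_exists:
  fixes C :: "'a::{real_inner,complete_space} set"
  assumes C: "subspace C" "closed C"
  obtains y where "y \<in> C" "\<And>z. z \<in> C \<Longrightarrow> inner (x - y) z = 0"
proof -
  define d where "d = (INF z\<in>C. (norm (x - z))\<^sup>2)"
  have bdd: "bdd_below ((\<lambda>z. (norm (x - z))\<^sup>2) ` C)"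
    by (rule bdd_belowI[of _ 0]) auto
  have d_le: "d \<le> (norm (x - z))\<^sup>2" if "z \<in> C" for z
    unfolding d_def using bdd that by (rule cINF_lower)
  have "\<exists>z\<in>C. (norm (x - z))\<^sup>2 < d + 1 / Suc n" for n
  proof (rule ccontr)
    assume "\<not> ?thesis"
    then have "d + 1 / Suc n \<le> d"
      unfolding d_def by (intro cINF_greatest) (use C subspace_0 in \<open>auto simp: not_less\<close>)
    then show False by (simp add: field_simps)
  qed
  then obtain y where yC: "\<And>n. y n \<in> C" and y: "\<And>n. (norm (x - y n))\<^sup>2 < d + 1 / Suc n"
    by metis
  \<comment> \<open>Parallelogram law: the midpoint lies in \<open>C\<close>, so its squared
    distance to \<open>x\<close> is at least \<open>d\<close>, and only the two excesses over
    \<open>d\<close> remain.\<close>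
  have close: "(dist (y m) (y n))\<^sup>2 \<le> 2 / Suc m + 2 / Suc n" for m n
  proof -
    have "(1/2) *\<^sub>R (y m + y n) \<in> C"
      using C yC by (intro subspace_scale subspace_add)
    note d_le[OF this]
    moreover have "(dist (y m) (y n))\<^sup>2 =
        2 * (norm (x - y m))\<^sup>2 + 2 * (norm (x - y n))\<^sup>2 - 4 * (norm (x - (1/2) *\<^sub>R (y m + y n)))\<^sup>2"
      by (simp add: dist_norm power2_norm_eq_inner inner_diff_left inner_diff_right
          inner_add_left inner_add_right inner_commute algebra_simps)
    ultimately show ?thesis using y[of m] y[of n] by simp
  qed
  have "Cauchy y"
  proof (rule metric_CauchyI)
    fix e :: real assume e: "e > 0"
    obtain N where N: "4 / e\<^sup>2 < real N" using reals_Archimedean2 by blast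
    have N0: "N > 0"
      using N e less_trans[of 0 "4 / e\<^sup>2" "real N"] by auto
    have "dist (y m) (y n) < e" if "m \<ge> N" "n \<ge> N" for m n
    proof -
      have "2 / Suc m + 2 / Suc n \<le> 2 / N + 2 / N"
        using that N0 by (intro add_mono divide_left_mono) auto
      also have "\<dots> < e\<^sup>2" using N N0 e by (simp add: field_simps)
      finally have "(dist (y m) (y n))\<^sup>2 < e\<^sup>2" using close[of m n] by linarith
      then show ?thesis using e by (auto intro: power2_less_imp_less)
    qed
    then show "\<exists>M. \<forall>m\<ge>M. \<forall>n\<ge>M. dist (y m) (y n) < e" by blast
  qed
  then obtain l where l: "y \<longlonglongrightarrow> l"
    using convergent_eq_Cauchy by blast
  have lC: "l \<in> C" using \<open>closed C\<close> yC l closed_sequentially by blast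
  have "(\<lambda>n. (norm (x - y n))\<^sup>2) \<longlonglongrightarrow> (norm (x - l))\<^sup>2"
    using l by (intro tendsto_intros)
  moreover have "(\<lambda>n. d + 1 / Suc n) \<longlonglongrightarrow> d + 0"
    by (intro tendsto_intros LIMSEQ_Suc lim_1_over_n)
  ultimately have min: "(norm (x - l))\<^sup>2 \<le> d"
    using y by (intro LIMSEQ_le[of _ _ "\<lambda>n. d + 1 / Suc n"]) (auto intro: less_imp_le)
  have "inner (x - l) z = 0" if z: "z \<in> C" for z
  proof (cases "z = 0")
    case False
    \<comment> \<open>The minimiser of the quadratic
      \<open>t \<mapsto> (norm (x - (l + t *\<^sub>R z)))\<^sup>2\<close>.\<close>
    define t where "t = inner (x - l) z / inner z z"
    have "l + t *\<^sub>R z \<in> C" using C lC z by (intro subspace_add subspace_scale)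
    from d_le[OF this] min have "(norm (x - l))\<^sup>2 \<le> (norm (x - (l + t *\<^sub>R z)))\<^sup>2" by linarith
    also have "\<dots> = (norm (x - l))\<^sup>2 - 2 * t * inner (x - l) z + t * t * inner z z"
      by (simp add: power2_norm_eq_inner inner_diff_left inner_diff_right
          inner_add_left inner_add_right inner_commute algebra_simps)
    also have "t * t * inner z z = t * inner (x - l) z"
      using False by (simp add: t_def)
    finally have "t * inner (x - l) z \<le> 0" by linarith
    moreover have "inner z z > 0" using False by simp
    ultimately have "(inner (x - l) z)\<^sup>2 \<le> 0"
      by (simp add: t_def power2_eq_square divide_le_0_iff)
    then show ?thesis by simp
  qed simp
  with lC that show ?thesis by blast
qed

text \<open>Continuous induction: the bound \<open>g a \<le> g y\<close> reaches the supremum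
  \<open>c\<close> of its range by the left condition and passes beyond it by the right one. The
  left condition permits upward jumps, so it holds for a continuous function plus a nondecreasing
  one.\<close>

lemma right_increase_imp_le:
  fixes g :: "real \<Rightarrow> real"
  assumes "a \<le> b"
    and right: "\<And>x. x \<in> {a..<b} \<Longrightarrow> \<forall>\<^sub>F y in at_right x. g x \<le> g y"
    and left: "\<And>x e. x \<in> {a<..b} \<Longrightarrow> 0 < e \<Longrightarrow> \<forall>\<^sub>F y in at_left x. g y - e \<le> g x"
  shows "g a \<le> g b"
proof -
  define S where "S = {x \<in> {a..b}. \<forall>y\<in>{a..x}. g a \<le> g y}"
  define c where "c = Sup S"
  have aS: "a \<in> S" using \<open>a \<le> b\<close> by (auto simp: S_def)
  have bdd: "bdd_above S" by (auto simp: S_def intro!: bdd_aboveI[of _ b])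
  have "a \<le> c"
    unfolding c_def using aS bdd by (rule cSup_upper)
  moreover have "c \<le> b"
    unfolding c_def using aS by (intro cSup_least) (auto simp: S_def)
  ultimately have c: "a \<le> c" "c \<le> b" by auto
  have below: "g a \<le> g y" if "a \<le> y" "y < c" for y
  proof -
    obtain x where "x \<in> S" "y < x"
      using less_cSupD[of S y] \<open>y < c\<close> aS by (auto simp: c_def)
    then show ?thesis using that by (auto simp: S_def)
  qed
  have gc: "g a \<le> g c"
  proof (cases "a = c")
    case False
    have "g a \<le> g c + e" if "e > 0" for e
    proof -
      have "\<forall>\<^sub>F y in at_left c. g y - e \<le> g c" using left[of c e] c False that by auto
      moreover have "\<forall>\<^sub>F y in at_left c. y \<in> {a<..<c}"
        using c False by (intro eventually_at_leftI[of a]) auto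
      ultimately have "\<forall>\<^sub>F y in at_left c. g a \<le> g c + e"
      proof eventually_elim
        case (elim y)
        then show ?case using below[of y] by auto
      qed
      then show ?thesis by simp
    qed
    then show ?thesis by (rule field_le_epsilon)
  qed simp
  have "c = b"
  proof (rule ccontr)
    assume "c \<noteq> b"
    then have "c < b" using c by simp
    then obtain d where d: "d > c" "\<And>y. c < y \<Longrightarrow> y < d \<Longrightarrow> g c \<le> g y"
      using right[of c] c by (auto simp: eventually_at_right_field)
    define z where "z = min ((c + d) / 2) b"
    have "c < z" "z < d" "z \<le> b" using d \<open>c < b\<close> by (auto simp: z_def min_def field_simps)
    moreover have "g a \<le> g y" if "a \<le> y" "y \<le> z" for y
    proof -
      consider "y < c" | "y = c" | "c < y" by linarith
      then show ?thesis
        using below[of y] gc d(2)[of y] that \<open>z < d\<close> by cases auto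
    qed
    ultimately have "z \<in> S" using c by (auto simp: S_def)
    then show False using cSup_upper[OF _ bdd, of z] \<open>c < z\<close> by (simp add: c_def)
  qed
  then show ?thesis using gc by simp
qed

text \<open>On the exceptional null set the right derivative is merely finite; it is dominated there by an
  increasing function \<open>\<sigma>\<close> of arbitrarily small total variation whose derivative is \<open>\<infinity>\<close>.\<close>

lemma AE_nonneg_right_derivative_imp_le:
  fixes f D :: "real \<Rightarrow> real"
  assumes "a \<le> b" and cont: "continuous_on {a..b} f"
    and der: "\<And>x. x \<in> {a..<b} \<Longrightarrow> (f has_real_derivative D x) (at_right x)"
    and AE: "AE x in lborel. x \<in> {a..<b} \<longrightarrow> 0 \<le> D x"
  shows "f a \<le> f b"
proof (rule field_le_epsilon)
  fix \<epsilon> :: real assume "\<epsilon> > 0"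
  \<comment> \<open>The error budget: \<sigma> will contribute at most \<open>2 * e\<close> and the
    linear term of \<open>g\<close> exactly \<open>e * (b - a)\<close>.\<close>
  define e where "e = \<epsilon> / (2 + (b - a))"
  have e: "e > 0" "e * (2 + (b - a)) = \<epsilon>" using \<open>\<epsilon> > 0\<close> \<open>a \<le> b\<close> by (auto simp: e_def)
  obtain N where N: "N \<in> null_sets lborel" "\<And>x. x \<in> space lborel - N \<Longrightarrow> x \<in> {a..<b} \<longrightarrow> 0 \<le> D x"
    by (rule AE_E3[OF AE]) (rule that)
  have "\<exists>G. open G \<and> N \<subseteq> G \<and> emeasure lborel G < ennreal (e * (1/2)^n)" for n
  proof -
    have "N \<in> sets borel" "emeasure lborel N = 0" using N(1) by auto
    moreover obtain G where "open G" "N \<subseteq> G" "emeasure lborel (G - N) < ennreal (e * (1/2)^n)"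
      using outer_regular_lborel[of N "e * (1/2)^n"] \<open>N \<in> sets borel\<close> e by auto
    moreover have "emeasure lborel (G - N) = emeasure lborel G"
      using N(1) \<open>open G\<close> by (intro emeasure_Diff_null_set) auto
    ultimately show ?thesis by auto
  qed
  then obtain G where Gopen: "\<And>n. open (G n)" and NG: "\<And>n. N \<subseteq> G n"
      and Gsmall: "\<And>n::nat. emeasure lborel (G n) < ennreal (e * (1/2)^n)"
    by metis
  \<comment> \<open>Each \<open>s n\<close> has slope 1 inside \<open>G n\<close>. A point of
    \<open>N\<close> is interior to every \<open>G n\<close>, so the sum over \<open>n\<close> has
    arbitrarily large slope there, while its total is at most the geometric sum
    \<open>2 * e\<close>.\<close>
  define s where "s n x = measure lborel (G n \<inter> {a..x})" for n x
  have s0: "0 \<le> s n x" for n x by (simp add: s_def)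
  have fin: "G n \<inter> A \<in> fmeasurable lborel" if "A \<in> sets borel" for n A
  proof (rule fmeasurableI)
    have "emeasure lborel (G n \<inter> A) \<le> emeasure lborel (G n)"
      using Gopen[of n] by (intro emeasure_mono) auto
    then show "emeasure lborel (G n \<inter> A) < \<infinity>"
      unfolding infinity_ennreal_def by (rule le_less_trans) (rule less_trans[OF Gsmall ennreal_less_top])
  qed (use Gopen[of n] that in auto)
  have s_le: "s n x \<le> e * (1/2)^n" for n x
  proof -
    have "emeasure lborel (G n \<inter> {a..x}) \<le> emeasure lborel (G n)"
      using Gopen[of n] by (intro emeasure_mono) auto
    then have "emeasure lborel (G n \<inter> {a..x}) \<le> ennreal (e * (1/2)^n)"
      using Gsmall[of n] by simp
    then show ?thesis
      unfolding s_def measure_def using e by (simp add: enn2real_leI)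
  qed
  have s_diff: "s n y - s n x = measure lborel (G n \<inter> {x<..y})" if "a \<le> x" "x \<le> y" for n x y
  proof -
    have "G n \<inter> {a..y} = (G n \<inter> {a..x}) \<union> (G n \<inter> {x<..y})" using that by auto
    then have "s n y = s n x + measure lborel (G n \<inter> {x<..y})"
      unfolding s_def by (simp only:) (rule measure_Union[OF _ _ ], auto intro!: fin simp: Gopen fmeasurableD2[OF fin])
    then show ?thesis by simp
  qed
  have geo: "summable (\<lambda>n. e * (1/2)^n)" "(\<Sum>n. e * (1/2)^n) = 2 * e"
    by (auto intro!: summable_mult simp: suminf_mult suminf_geometric)
  have summ: "summable (\<lambda>n. s n x)" for x
    by (rule summable_comparison_test'[OF geo(1)]) (use s0 s_le in auto)
  define \<sigma> where "\<sigma> x = (\<Sum>n. s n x)" for x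
  \<comment> \<open>The case \<open>k = 0\<close> says that \<sigma> is nondecreasing.\<close>
  have \<sigma>_incr: "k * (y - x) \<le> \<sigma> y - \<sigma> x"
    if "a \<le> x" "x \<le> y" and k: "\<And>n. n < k \<Longrightarrow> {x<..y} \<subseteq> G n" for x y :: real and k :: nat
  proof -
    have "k * (y - x) = (\<Sum>n<k. s n y - s n x)"
      using that by (simp add: s_diff Int_absorb1)
    also have "\<dots> \<le> (\<Sum>n. s n y - s n x)"
      using that by (intro sum_le_suminf summable_diff summ) (auto simp: s_diff)
    also have "\<dots> = \<sigma> y - \<sigma> x"
      unfolding \<sigma>_def by (rule suminf_diff[symmetric]) (rule summ)+
    finally show ?thesis .
  qed
  define g where "g x = f x + \<sigma> x + e * x" for x
  have "g a \<le> g b"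
  proof (rule right_increase_imp_le[OF \<open>a \<le> b\<close>])
    fix x assume x: "x \<in> {a..<b}"
    have quot: "((\<lambda>y. (f y - f x) / (y - x)) \<longlongrightarrow> D x) (at_right x)"
      using der[OF x] by (simp add: has_field_derivative_iff)
    have gt: "\<forall>\<^sub>F y in at_right x. x < y" by (simp add: eventually_at_right_less)
    show "\<forall>\<^sub>F y in at_right x. g x \<le> g y"
    proof (cases "x \<in> N")
      case False
      then have "0 \<le> D x" using N(2) x by auto
      then have "\<forall>\<^sub>F y in at_right x. - e < (f y - f x) / (y - x)"
        using e by (intro order_tendstoD(1)[OF quot]) auto
      then show ?thesis using gt
      proof eventually_elim
        case (elim y)
        then have "- e * (y - x) \<le> f y - f x" by (simp add: field_simps)
        moreover have "0 \<le> \<sigma> y - \<sigma> x" using \<sigma>_incr[where x=x and y=y and k=0] x elim by simp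
        ultimately show ?case by (simp add: g_def algebra_simps)
      qed
    next
      case True
      \<comment> \<open>Near \<open>x\<close> the quotients of \<open>f\<close> stay above
        \<open>D x - 1\<close>, and slope \<open>k\<close> of \<sigma> compensates for this.\<close>
      obtain k :: nat where k: "1 - D x \<le> k" using real_arch_simple by blast
      have "open (\<Inter>n<k. G n)" "x \<in> (\<Inter>n<k. G n)" using Gopen NG True by auto
      then obtain r where r: "r > 0" "ball x r \<subseteq> (\<Inter>n<k. G n)"
        using openE by blast
      have "\<forall>\<^sub>F y in at_right x. D x - 1 < (f y - f x) / (y - x)"
        by (intro order_tendstoD(1)[OF quot]) auto
      moreover have "\<forall>\<^sub>F y in at_right x. y < x + r"
        using r by (intro eventually_at_rightI[of x "x + r"]) auto
      ultimately show ?thesis using gt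
      proof eventually_elim
        case (elim y)
        then have "(D x - 1) * (y - x) \<le> f y - f x" by (simp add: field_simps)
        moreover have "{x<..y} \<subseteq> G n" if "n < k" for n
        proof -
          have "{x<..y} \<subseteq> ball x r" using elim by (auto simp: dist_real_def)
          then show ?thesis using r that by blast
        qed
        then have "k * (y - x) \<le> \<sigma> y - \<sigma> x" using \<sigma>_incr[where x=x and y=y and k=k] x elim by auto
        moreover have "(1 - D x) * (y - x) \<le> k * (y - x)"
          using k elim by (intro mult_right_mono) auto
        moreover have "0 \<le> e * (y - x)" using e elim by simp
        ultimately show ?case by (simp add: g_def algebra_simps)
      qed
    qed
  next
    fix x d :: real assume x: "x \<in> {a<..b}" and d: "0 < d"
    have "continuous_on {a..x} f"
      using x by (intro continuous_on_subset[OF cont]) auto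
    then have "(f \<longlongrightarrow> f x) (at_left x)"
      using x by (intro continuous_on_Icc_at_leftD) auto
    then have "\<forall>\<^sub>F y in at_left x. f y < f x + d"
      using d by (intro order_tendstoD(2)) auto
    moreover have "\<forall>\<^sub>F y in at_left x. y \<in> {a<..<x}"
      using x by (intro eventually_at_leftI[of a]) auto
    ultimately show "\<forall>\<^sub>F y in at_left x. g y - d \<le> g x"
    proof eventually_elim
      case (elim y)
      moreover have "0 \<le> \<sigma> x - \<sigma> y" using \<sigma>_incr[where x=y and y=x and k=0] elim by simp
      moreover have "e * y \<le> e * x" using e elim by auto
      ultimately show ?case by (simp add: g_def)
    qed
  qed
  moreover have "\<sigma> b \<le> 2 * e"
    unfolding \<sigma>_def geo(2)[symmetric] by (intro suminf_le s_le summ geo(1))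
  moreover have "0 \<le> \<sigma> a" unfolding \<sigma>_def by (intro suminf_nonneg summ s0)
  ultimately show "f a \<le> f b + \<epsilon>"
    using e(2) by (simp add: g_def algebra_simps)
qed

text \<open>By the previous lemma on \<open>{t..y}\<close>, every right difference quotient at
  \<open>t\<close> is nonnegative, hence so is the limit. This upgrades almost every time to every
  time.\<close>

lemma AE_nonneg_right_derivative_imp_nonneg:
  fixes f D :: "real \<Rightarrow> real"
  assumes cont: "continuous_on {a..} f"
    and der: "\<And>x. a \<le> x \<Longrightarrow> (f has_real_derivative D x) (at_right x)"
    and AE: "AE x in lborel. a \<le> x \<longrightarrow> 0 \<le> D x" and "a \<le> t"
  shows "0 \<le> D t"
proof (rule tendsto_lowerbound)
  show "((\<lambda>y. (f y - f t) / (y - t)) \<longlongrightarrow> D t) (at_right t)"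
    using der[OF \<open>a \<le> t\<close>] by (simp add: has_field_derivative_iff)
  show "\<forall>\<^sub>F y in at_right t. 0 \<le> (f y - f t) / (y - t)"
    using eventually_at_right_less[of t]
  proof eventually_elim
    case (elim y)
    have "f t \<le> f y"
    proof (rule AE_nonneg_right_derivative_imp_le[of t y f D])
      show "continuous_on {t..y} f" using cont \<open>a \<le> t\<close> by (rule_tac continuous_on_subset) auto
      show "AE x in lborel. x \<in> {t..<y} \<longrightarrow> 0 \<le> D x" using AE \<open>a \<le> t\<close> by auto
    qed (use elim der \<open>a \<le> t\<close> in auto)
    then show ?case using elim by simp
  qed
qed simp

section \<open>Square-integrable functions and the spaces \<open>H X\<close>\<close>

interpretation mOmega: finite_measure mOmega
  by (rule finite_measure_mOmega)

lemma measure_mOmega_Omega [simp]: "measure mOmega Omega = 1"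
  using finite_measure_mOmega(2) by (simp add: mOmega_def space_restrict_space)

lemma space_mOmega [simp]: "space mOmega = Omega"
  by (simp add: mOmega_def space_restrict_space)

lemma sets_mOmega_iff: "A \<in> sets mOmega \<longleftrightarrow> A \<in> sets borel \<and> A \<subseteq> Omega"
  by (auto simp: mOmega_def Omega_def sets_restrict_space_iff)

lemma borel_measurable_mOmegaI [measurable (raw)]:
  "f \<in> borel_measurable borel \<Longrightarrow> f \<in> borel_measurable mOmega"
  by (auto simp: mOmega_def intro!: measurable_restrict_space1)

lemma AE_mOmega_iff: "(AE m in mOmega. P m) \<longleftrightarrow> (AE m in lborel. m \<in> Omega \<longrightarrow> P m)"
  unfolding mOmega_def by (rule AE_restrict_space_iff) (simp add: Omega_def)

lemma AE_mOmega_neq: "AE m in mOmega. m \<noteq> p"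
  unfolding AE_mOmega_iff using AE_lborel_singleton[of p] by auto

lemma sq_integrable_const: "sq_integrable (\<lambda>_. c)"
  by (simp add: sq_integrable_def)

lemma sq_integrable_diff:
  assumes "sq_integrable f" "sq_integrable g"
  shows "sq_integrable (\<lambda>m. f m - g m)"
  using sq_integrable_add[OF assms(1) sq_integrable_uminus[OF assms(2)]] by simp

lemma sq_integrable_abs: "sq_integrable f \<Longrightarrow> sq_integrable (\<lambda>m. \<bar>f m\<bar>)"
  by (auto simp: sq_integrable_def intro: borel_measurable_abs)

lemma sq_integrable_dominated:
  assumes "f \<in> borel_measurable mOmega" "sq_integrable g" "\<And>m. m \<in> Omega \<Longrightarrow> \<bar>f m\<bar> \<le> \<bar>g m\<bar>"
  shows "sq_integrable f"
  unfolding sq_integrable_def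
proof (intro conjI)
  show "integrable mOmega (\<lambda>m. (f m)\<^sup>2)"
  proof (rule Bochner_Integration.integrable_bound)
    show "integrable mOmega (\<lambda>m. (g m)\<^sup>2)" using assms by (simp add: sq_integrable_def)
    show "AE m in mOmega. norm ((f m)\<^sup>2) \<le> norm ((g m)\<^sup>2)"
      using assms(3) by (auto intro!: AE_I2 simp: abs_le_square_iff)
  qed (use assms in measurable)
qed fact

lemma sq_integrable_imp_integrable: "sq_integrable f \<Longrightarrow> integrable mOmega f"
  using sq_integrable_mult[OF _ sq_integrable_const[of 1]] by simp

section \<open>Passing between functions and their classes\<close>

lemma abs_l2_eqI:
  "sq_integrable f \<Longrightarrow> sq_integrable g \<Longrightarrow> AE m in mOmega. f m = g m \<Longrightarrow> abs_l2 f = abs_l2 g"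
  by (intro Quotient3_rel_abs[OF Quotient3_l2]) (simp add: l2_eq_def)

lemma rep_abs_l2: "sq_integrable f \<Longrightarrow> AE m in mOmega. rep_l2 (abs_l2 f) m = f m"
  using Quotient3_rep_abs[OF Quotient3_l2, of f] by (simp add: l2_eq_def)

lemma abs_l2_add:
  "sq_integrable f \<Longrightarrow> sq_integrable g \<Longrightarrow> abs_l2 (\<lambda>m. f m + g m) = abs_l2 f + abs_l2 g"
  by (simp add: plus_l2.abs_eq l2_eq_def)

lemma abs_l2_diff:
  "sq_integrable f \<Longrightarrow> sq_integrable g \<Longrightarrow> abs_l2 (\<lambda>m. f m - g m) = abs_l2 f - abs_l2 g"
  using abs_l2_add[of f "\<lambda>m. - g m"]
  by (simp add: minus_l2_def uminus_l2.abs_eq l2_eq_def sq_integrable_uminus)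

lemma abs_l2_scale: "sq_integrable f \<Longrightarrow> abs_l2 (\<lambda>m. c * f m) = c *\<^sub>R abs_l2 f"
  by (simp add: scaleR_l2.abs_eq l2_eq_def)

lemma norm_abs_l2: "sq_integrable f \<Longrightarrow> (norm (abs_l2 f))\<^sup>2 = (\<integral>m. (f m)\<^sup>2 \<partial>mOmega)"
  by (simp add: power2_norm_eq_inner inner_abs_l2 flip: power2_eq_square)

lemma norm_abs_l2_mono:
  assumes "sq_integrable f" "sq_integrable g" "\<And>m. m \<in> Omega \<Longrightarrow> \<bar>f m\<bar> \<le> \<bar>g m\<bar>"
  shows "norm (abs_l2 f) \<le> norm (abs_l2 g)"
proof (rule power2_le_imp_le)
  show "(norm (abs_l2 f))\<^sup>2 \<le> (norm (abs_l2 g))\<^sup>2"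
    using assms unfolding norm_abs_l2[OF assms(1)] norm_abs_l2[OF assms(2)]
    by (intro integral_mono) (auto simp: sq_integrable_def abs_le_square_iff)
qed simp

lemma integral_le_norm_abs_l2:
  assumes "sq_integrable f"
  shows "(\<integral>m. f m \<partial>mOmega) \<le> norm (abs_l2 f)"
proof -
  have "(\<integral>m. f m \<partial>mOmega) = inner (abs_l2 f) (abs_l2 (\<lambda>_. 1))"
    using assms by (simp add: inner_abs_l2 sq_integrable_const)
  also have "\<dots> \<le> norm (abs_l2 f) * norm (abs_l2 (\<lambda>_. 1))"
    by (rule norm_cauchy_schwarz)
  also have "norm (abs_l2 (\<lambda>_. 1)) = 1"
    by (simp add: norm_eq_sqrt_inner inner_abs_l2 sq_integrable_const)
  finally show ?thesis by simp
qed

lemma inner_abs_l2_right: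
  assumes "sq_integrable g"
  shows "inner U (abs_l2 g) = (\<integral>m. rep_l2 U m * g m \<partial>mOmega)"
  using inner_abs_l2[OF sq_integrable_rep assms, of U] by (simp add: abs_rep_l2)

lemma rep_l2_measurable [measurable]: "rep_l2 U \<in> borel_measurable mOmega"
  using sq_integrable_rep[of U] by (simp add: sq_integrable_def)

section \<open>Nondecreasing versions and the set of local constancy\<close>

lemma nondecr_version_version: "X \<in> K \<Longrightarrow> nondecr_version X (version X)"
  unfolding K_def version_def by (auto intro: someI[of "nondecr_version X"])

lemma
  assumes "X \<in> K"
  shows sq_integrable_version: "sq_integrable (version X)"
    and abs_l2_version: "abs_l2 (version X) = X"
    and mono_on_version: "mono_on Omega (version X)"
    and continuous_version: "\<And>m. m \<in> Omega \<Longrightarrow> continuous (at_right m) (version X)"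
  using nondecr_version_version[OF assms] by (auto simp: nondecr_version_def)

lemma Omega_const_subset: "Omega_const X \<subseteq> Omega"
  by (auto simp: Omega_const_def)

lemma open_Omega_const: "open (Omega_const X)"
  unfolding open_contains_ball
proof
  fix m assume "m \<in> Omega_const X"
  then obtain e where e: "e > 0" "{m - e<..<m + e} \<subseteq> Omega" "version X constant_on {m - e<..<m + e}"
    by (auto simp: Omega_const_def)
  have "x \<in> Omega_const X" if x: "x \<in> ball m e" for x
  proof -
    define d where "d = e - \<bar>x - m\<bar>"
    have d: "d > 0" "{x - d<..<x + d} \<subseteq> {m - e<..<m + e}"
      using x by (auto simp: d_def dist_real_def abs_if split: if_splits)
    moreover have "x \<in> Omega" using e(2) x by (auto simp: dist_real_def abs_if split: if_splits)
    moreover have "version X constant_on {x - d<..<x + d}"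
      using constant_on_subset[OF e(3) d(2)] .
    ultimately show ?thesis using e(2) unfolding Omega_const_def by blast
  qed
  with e(1) show "\<exists>e>0. ball m e \<subseteq> Omega_const X" by blast
qed

text \<open>A locally constant function on a connected set is constant.\<close>

lemma version_constant_on_interval:
  assumes I: "is_interval I" "I \<subseteq> Omega_const X"
  shows "version X constant_on I"
proof -
  have eq: "version X a = version X b" if ab: "a \<in> I" "b \<in> I" for a b
  proof (rule connected_local_const[where A = I and f = "version X"])
    show "connected I" using I(1) by (simp add: is_interval_connected_1)
    show "\<forall>a\<in>I. \<forall>\<^sub>F b in at a within I. version X a = version X b"
    proof
      fix m assume "m \<in> I"
      then obtain e where e: "e > 0" "version X constant_on {m - e<..<m + e}"
        using I(2) by (auto simp: Omega_const_def)
      have "\<forall>\<^sub>F b in at m within I. b \<in> {m - e<..<m + e}"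
        unfolding eventually_at using e(1)
        by (intro exI[of _ e]) (auto simp: dist_real_def abs_less_iff)
      then show "\<forall>\<^sub>F b in at m within I. version X m = version X b"
        by eventually_elim (use e in \<open>auto simp: constant_on_def\<close>)
    qed
  qed fact+
  show ?thesis
  proof (cases "I = {}")
    case False
    then obtain a where "a \<in> I" by blast
    then show ?thesis using eq unfolding constant_on_def by (intro exI[of _ "version X a"]) blast
  qed (simp add: constant_on_def)
qed

lemma interval_borel:
  fixes I :: "real set"
  assumes "is_interval I"
  shows "I \<in> sets borel"
proof -
  have "\<exists>a b. I = {} \<or> I = UNIV \<or> I = {..<b} \<or> I = {..b} \<or> I = {a<..} \<or> I = {a..} \<or>
      I = {a<..<b} \<or> I = {a<..b} \<or> I = {a..<b} \<or> I = {a..b}"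
    using assms unfolding is_interval_1 by (intro interval_cases) blast
  then show ?thesis by auto
qed

text \<open>Being almost everywhere constant on \<open>I\<close> amounts to being orthogonal to all
  mean-zero functions supported in \<open>I\<close>. This exhibits \<open>H X\<close> as an
  intersection of kernels of continuous functionals, hence as a closed subspace.\<close>

lemma H_iff_orthogonal:
  "U \<in> H X \<longleftrightarrow> (\<forall>I g. is_interval I \<and> I \<subseteq> Omega_const X \<and> sq_integrable g \<and>
     (\<forall>m. m \<notin> I \<longrightarrow> g m = 0) \<and> (\<integral>m. g m \<partial>mOmega) = 0 \<longrightarrow> inner U (abs_l2 g) = 0)"
  (is "_ \<longleftrightarrow> ?R")
proof
  assume U: "U \<in> H X"
  show ?R
  proof (intro allI impI, elim conjE)
    fix I g assume I: "is_interval I" "I \<subseteq> Omega_const X" and g: "sq_integrable g"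
      and supp: "\<forall>m. m \<notin> I \<longrightarrow> g m = 0" and mean: "(\<integral>m. g m \<partial>mOmega) = 0"
    have [measurable]: "g \<in> borel_measurable mOmega" using g by (simp add: sq_integrable_def)
    obtain c where c: "AE m in mOmega. m \<in> I \<longrightarrow> rep_l2 U m = c"
      using U I unfolding H_def by blast
    have "inner U (abs_l2 g) = (\<integral>m. c * g m \<partial>mOmega)"
      unfolding inner_abs_l2_right[OF g]
    proof (rule integral_cong_AE)
      show "AE m in mOmega. rep_l2 U m * g m = c * g m"
        using c by eventually_elim (use supp in auto)
    qed measurable
    then show "inner U (abs_l2 g) = 0" using mean by simp
  qed
next
  assume R: ?R
  show "U \<in> H X"
    unfolding H_def
  proof (clarify)
    fix I assume I: "is_interval I" "I \<subseteq> Omega_const X"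
    have Is: "I \<in> sets mOmega"
      using I interval_borel Omega_const_subset[of X] by (auto simp: sets_mOmega_iff)
    note [measurable] = Is
    define u where "u m = rep_l2 U m * indicator I m" for m
    \<comment> \<open>The mean of \<open>U\<close> over \<open>I\<close>, so that \<open>g\<close>
      is the deviation of \<open>U\<close> from it. For a null \<open>I\<close> the quotient is the
      default 0, and that case is settled separately.\<close>
    define c where "c = (\<integral>m. u m \<partial>mOmega) / measure mOmega I"
    define g where "g m = (rep_l2 U m - c) * indicator I m" for m
    have u: "sq_integrable u"
      by (rule sq_integrable_dominated[OF _ sq_integrable_rep[of U]])
        (auto simp: u_def[abs_def] split: split_indicator)
    have ind: "sq_integrable (indicator I)"
      by (rule sq_integrable_dominated[OF _ sq_integrable_const[of 1]]) (auto split: split_indicator)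
    have g_eq: "g m = u m - c * indicator I m" for m by (simp add: g_def u_def algebra_simps)
    have g: "sq_integrable g"
      unfolding g_eq[abs_def] by (intro sq_integrable_diff u sq_integrable_scale ind)
    have inds: "(\<integral>m. indicator I m \<partial>mOmega) = measure mOmega I"
      using Is by (simp add: Int_absorb2[of I Omega] sets_mOmega_iff)
    show "\<exists>c. AE m in mOmega. m \<in> I \<longrightarrow> rep_l2 U m = c"
    proof (cases "measure mOmega I = 0")
      case True
      then have "I \<in> null_sets mOmega"
        using Is by (auto simp: mOmega.emeasure_eq_measure)
      then have "AE m in mOmega. m \<notin> I" by (rule AE_not_in)
      then show ?thesis by (auto elim: eventually_mono)
    next
      case False
      have "(\<integral>m. g m \<partial>mOmega) = (\<integral>m. u m \<partial>mOmega) - (\<integral>m. c * indicator I m \<partial>mOmega)"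
        unfolding g_eq
        by (intro Bochner_Integration.integral_diff sq_integrable_imp_integrable u sq_integrable_scale ind)
      then have mean: "(\<integral>m. g m \<partial>mOmega) = 0"
        using False by (simp only: integral_mult_right_zero inds) (simp add: c_def)
      have g_zero: "g m = 0" if "m \<notin> I" for m using that by (simp add: g_def)
      \<comment> \<open>On \<open>I\<close> the function \<open>U\<close> equals
        \<open>g + c\<close>, and \<open>g\<close> has mean zero, so this pairing is the squared
        norm of \<open>g\<close>.\<close>
      have "0 = inner U (abs_l2 g)"
        using R[rule_format, of I g] I g mean by (simp add: g_zero)
      also have "\<dots> = (\<integral>m. (g m)\<^sup>2 + c * g m \<partial>mOmega)"
        unfolding inner_abs_l2_right[OF g]
        by (intro Bochner_Integration.integral_cong) (auto simp: g_def power2_eq_square algebra_simps split: split_indicator)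
      also have "\<dots> = (\<integral>m. (g m)\<^sup>2 \<partial>mOmega)"
        using g mean by (subst Bochner_Integration.integral_add)
          (auto simp: sq_integrable_def intro: sq_integrable_imp_integrable[OF g])
      finally have "AE m in mOmega. (g m)\<^sup>2 = 0"
        using g by (subst (asm) eq_commute) (subst (asm) integral_nonneg_eq_0_iff_AE, auto simp: sq_integrable_def)
      then have "AE m in mOmega. m \<in> I \<longrightarrow> rep_l2 U m = c"
        by eventually_elim (auto simp: g_def)
      then show ?thesis by blast
    qed
  qed
qed

lemma subspace_H: "subspace (H X)"
  unfolding subspace_def by (auto simp: H_iff_orthogonal inner_add_left)

lemma closed_H: "closed (H X)"
proof -
  let ?S = "{abs_l2 g |I g. is_interval I \<and> I \<subseteq> Omega_const X \<and> sq_integrable g \<and>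
     (\<forall>m. m \<notin> I \<longrightarrow> g m = 0) \<and> (\<integral>m. g m \<partial>mOmega) = 0}"
  have "H X = (\<Inter>S\<in>?S. {U. inner U S = 0})"
    unfolding set_eq_iff H_iff_orthogonal by blast
  moreover have "closed {U. inner U S = 0}" for S :: l2
    by (intro closed_Collect_eq continuous_intros)
  ultimately show ?thesis by (auto intro!: closed_INT)
qed

lemma H_antimono: "Omega_const X \<subseteq> Omega_const Y \<Longrightarrow> H Y \<subseteq> H X"
  unfolding H_def by blast

lemma abs_l2_in_HI:
  assumes "sq_integrable f" and const: "\<And>I. is_interval I \<Longrightarrow> I \<subseteq> Omega_const X \<Longrightarrow> f constant_on I"
  shows "abs_l2 f \<in> H X"
  unfolding H_def
proof clarify
  fix I assume "is_interval I" "I \<subseteq> Omega_const X"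
  then obtain c where "\<forall>m\<in>I. f m = c" using const unfolding constant_on_def by blast
  moreover note rep_abs_l2[OF assms(1)]
  ultimately show "\<exists>c. AE m in mOmega. m \<in> I \<longrightarrow> rep_l2 (abs_l2 f) m = c"
    by (intro exI[of _ c]) (auto elim: eventually_mono)
qed

text \<open>Serves \<open>X\<close> itself, with \<open>T\<close> the identity, and the alignment
  force, which depends on \<open>m\<close> only through the value of \<open>X\<close> at
  \<open>m\<close>.\<close>

lemma comp_version_in_H:
  assumes "sq_integrable (\<lambda>m. T (version X m))"
  shows "abs_l2 (\<lambda>m. T (version X m)) \<in> H X"
proof (rule abs_l2_in_HI[OF assms])
  fix I assume "is_interval I" "I \<subseteq> Omega_const X"
  from version_constant_on_interval[OF this] show "(\<lambda>m. T (version X m)) constant_on I"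
    unfolding constant_on_def by metis
qed

lemma K_subset_H: "X \<in> K \<Longrightarrow> X \<in> H X"
  using comp_version_in_H[of "\<lambda>x. x" X] by (simp add: sq_integrable_version abs_l2_version)

section \<open>Membership in the cone and the polar form of the subdifferential\<close>

lemma K_I:
  assumes "sq_integrable f" "mono_on Omega f" "\<And>m. m \<in> Omega \<Longrightarrow> continuous (at_right m) f"
  shows "abs_l2 f \<in> K"
  using assms by (auto simp: K_def nondecr_version_def)

lemma comp_version_in_K:
  assumes X: "X \<in> K" and T: "mono T" "continuous_on UNIV T"
    and sq: "sq_integrable (\<lambda>m. T (version X m))"
  shows "abs_l2 (\<lambda>m. T (version X m)) \<in> K"
proof (rule K_I[OF sq])
  show "mono_on Omega (\<lambda>m. T (version X m))"
    using mono_on_version[OF X] T(1) by (auto simp: mono_on_def intro: monoD)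
next
  fix m assume "m \<in> Omega"
  then have "(version X \<longlongrightarrow> version X m) (at_right m)"
    using continuous_version[OF X] by (simp add: continuous_within)
  moreover have "isCont T (version X m)"
    using T(2) by (simp add: continuous_on_eq_continuous_at)
  ultimately show "continuous (at_right m) (\<lambda>m. T (version X m))"
    by (simp add: continuous_within isCont_tendsto_compose)
qed

lemma scale_in_K:
  assumes X: "X \<in> K" and c: "0 \<le> c"
  shows "c *\<^sub>R X \<in> K"
proof -
  have sq: "sq_integrable (\<lambda>m. c * version X m)"
    using X by (intro sq_integrable_scale sq_integrable_version)
  have "abs_l2 (\<lambda>m. c * version X m) \<in> K"
    by (rule comp_version_in_K[OF X _ _ sq]) (auto intro!: monoI mult_left_mono continuous_intros c)
  then show ?thesis using X by (simp add: abs_l2_scale sq_integrable_version abs_l2_version)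
qed

text \<open>\<open>K\<close> is a cone, so \<open>W\<close> may be tested against the multiples of
  \<open>X\<close> by 0 and by 2; this forces \<open>inner W X = 0\<close> and leaves membership in
  the polar cone.\<close>

lemma subdiff_K_iff:
  assumes "X \<in> K"
  shows "W \<in> subdiff_K X \<longleftrightarrow> (\<forall>Y\<in>K. inner W Y \<le> 0) \<and> inner W X = 0"
proof
  assume W: "W \<in> subdiff_K X"
  have le: "inner W Y \<le> inner W X" if "Y \<in> K" for Y
    using W that by (auto simp: subdiff_K_def inner_diff_right)
  have "inner W X = 0"
    using le[OF scale_in_K[OF assms, of 0]] le[OF scale_in_K[OF assms, of 2]] by simp
  then show "(\<forall>Y\<in>K. inner W Y \<le> 0) \<and> inner W X = 0" using le by auto
qed (auto simp: subdiff_K_def inner_diff_right)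

text \<open>The jump functions that generate \<open>K\<close> together with constants. For
  \<open>p\<close> between 0 and 1 the pairing with \<open>step p\<close> is the tail integral over
  \<open>{p..<1}\<close>, a primitive up to sign; \<open>step 0\<close> is the constant 1 and
  \<open>step 1\<close> is 0.\<close>

definition step :: "real \<Rightarrow> l2"
  where "step p = abs_l2 (indicator {p..<1})"

lemma sq_integrable_indicator: "A \<in> sets borel \<Longrightarrow> sq_integrable (indicator A)"
  by (rule sq_integrable_dominated[OF _ sq_integrable_const[of 1]]) (auto split: split_indicator)

lemma step_in_K: "step p \<in> K"
  unfolding step_def
proof (rule K_I)
  show "mono_on Omega (indicat_real {p..<1})"
    by (auto simp: mono_on_def Omega_def split: split_indicator)
next
  fix m assume m: "m \<in> Omega"
  have "\<forall>\<^sub>F x in at_right m. indicat_real {p..<1} m = indicator {p..<1} x"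
  proof (cases "p \<le> m")
    case True
    have "\<forall>\<^sub>F x in at_right m. x \<in> {m<..<1}"
      using m by (intro eventually_at_rightI[of m 1]) (auto simp: Omega_def)
    then show ?thesis
      by (rule eventually_mono) (use True m in \<open>auto simp: Omega_def split: split_indicator\<close>)
  next
    case False
    then have "\<forall>\<^sub>F x in at_right m. x \<in> {m<..<p}"
      using m by (intro eventually_at_rightI[of m p]) (auto simp: Omega_def)
    then show ?thesis by (rule eventually_mono) (use False in \<open>auto split: split_indicator\<close>)
  qed
  then have "(indicat_real {p..<1} \<longlongrightarrow> indicator {p..<1} m) (at_right m)"
    by (rule Lim_transform_eventually[OF tendsto_const])
  then show "continuous (at_right m) (indicat_real {p..<1})"
    by (simp add: continuous_within)
qed (simp add: sq_integrable_indicator)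

text \<open>The only possible jump inside \<open>Omega\<close> is at \<open>p\<close>, and an
  interval within \<open>Omega_const X\<close> avoids \<open>p\<close>, hence lies on one side of
  it.\<close>

lemma step_in_H:
  assumes "p \<notin> Omega_const X"
  shows "step p \<in> H X"
  unfolding step_def
proof (rule abs_l2_in_HI)
  fix I assume I: "is_interval I" "I \<subseteq> Omega_const X"
  then have "p \<notin> I" "I \<subseteq> Omega" using assms Omega_const_subset[of X] by auto
  have "x \<in> {p..<1} \<longleftrightarrow> y \<in> {p..<1}" if "x \<in> I" "y \<in> I" for x y
  proof -
    have "p \<le> x \<longleftrightarrow> p \<le> y"
      using I(1) \<open>p \<notin> I\<close> that mem_is_interval_1_I by (metis linear)
    then show ?thesis using \<open>I \<subseteq> Omega\<close> that by (auto simp: Omega_def)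
  qed
  then have "I \<subseteq> {p..<1} \<or> I \<inter> {p..<1} = {}" by blast
  then have "\<forall>x\<in>I. indicat_real {p..<1} x = (if I \<subseteq> {p..<1} then 1 else 0)"
    by (auto split: split_indicator)
  then show "indicat_real {p..<1} constant_on I"
    unfolding constant_on_def by blast
qed (simp add: sq_integrable_indicator)

lemma inner_step: "inner U (step p) = (\<integral>m. rep_l2 U m * indicator {p..<1} m \<partial>mOmega)"
  unfolding step_def by (rule inner_abs_l2_right) (simp add: sq_integrable_indicator)

lemma inner_step_1: "inner U (step 1) = 0"
  by (simp add: inner_step)

lemma inner_step_diff:
  assumes "p \<le> q" "q \<le> 1"
  shows "inner U (step p) - inner U (step q) = (\<integral>m. rep_l2 U m * indicator {p..<q} m \<partial>mOmega)"
proof -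
  have "step p - step q = abs_l2 (indicator {p..<q})"
    unfolding step_def using assms
    by (subst abs_l2_diff[symmetric])
      (auto intro!: sq_integrable_indicator arg_cong[of _ _ abs_l2] split: split_indicator)
  then show ?thesis
    by (simp add: inner_abs_l2_right sq_integrable_indicator flip: inner_diff_right)
qed

text \<open>On a component \<open>(a, b)\<close> of \<^term>\<open>Omega_const X\<close> the function \<open>Z\<close> is constant, so
  \<open>p \<mapsto> inner Z (step p)\<close> is affine there and its sign is decided at \<open>a\<close> and \<open>b\<close>.\<close>

lemma inner_step_nonpos:
  assumes Z: "Z \<in> H X" and out: "\<And>p. p \<in> Omega - Omega_const X \<Longrightarrow> inner Z (step p) \<le> 0"
    and zero: "inner Z (step 0) \<le> 0" and p: "p \<in> Omega"
  shows "inner Z (step p) \<le> 0"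
proof (cases "p \<in> Omega_const X")
  case True
  \<comment> \<open>The nearest points outside \<open>Omega_const X\<close> on either side of
    \<open>p\<close>. They exist because 0 and 1 are never in \<open>Omega_const X\<close> and its
    complement is closed.\<close>
  define a where "a = Sup ({0..p} - Omega_const X)"
  define b where "b = Inf ({p..1} - Omega_const X)"
  have p01: "0 < p" "p < 1" using p by (auto simp: Omega_def)
  have "0 \<notin> Omega_const X" "1 \<notin> Omega_const X"
    using Omega_const_subset[of X] by (auto simp: Omega_def)
  then have ne: "0 \<in> {0..p} - Omega_const X" "1 \<in> {p..1} - Omega_const X" using p01 by auto
  have cl: "closed ({0..p} - Omega_const X)" "closed ({p..1} - Omega_const X)"
    by (auto intro!: closed_Diff open_Omega_const)
  have bdd: "bdd_above ({0..p} - Omega_const X)" "bdd_below ({p..1} - Omega_const X)"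
    by (auto intro!: bdd_aboveI[of _ p] bdd_belowI[of _ p])
  have a: "a \<in> {0..p} - Omega_const X"
    unfolding a_def using ne by (intro closed_contains_Sup cl bdd) auto
  have b: "b \<in> {p..1} - Omega_const X"
    unfolding b_def using ne by (intro closed_contains_Inf cl bdd) auto
  have ab: "a < p" "p < b" using a b True by (auto simp: order.strict_iff_order)
  have sub: "{a<..<b} \<subseteq> Omega_const X"
  proof
    fix x assume x: "x \<in> {a<..<b}"
    show "x \<in> Omega_const X"
    proof (rule ccontr)
      assume "x \<notin> Omega_const X"
      then have "x \<le> a \<or> b \<le> x"
        using x a b cSup_upper[OF _ bdd(1), of x] cInf_lower[OF _ bdd(2), of x]
        unfolding a_def[symmetric] b_def[symmetric] by (cases "x \<le> p") auto
      then show False using x by auto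
    qed
  qed
  obtain c where c: "AE m in mOmega. m \<in> {a<..<b} \<longrightarrow> rep_l2 Z m = c"
    using Z sub unfolding H_def by (auto dest!: spec[of _ "{a<..<b}"])
  have int: "inner Z (step x) - inner Z (step y) = c * (y - x)" if "a \<le> x" "x \<le> y" "y \<le> b" for x y
  proof -
    have xy: "0 \<le> x" "y \<le> 1" using a b that by auto
    have "inner Z (step x) - inner Z (step y) = (\<integral>m. rep_l2 Z m * indicator {x..<y} m \<partial>mOmega)"
      using that xy by (intro inner_step_diff) auto
    also have "\<dots> = (\<integral>m. c * indicator {x..<y} m \<partial>mOmega)"
    proof (rule integral_cong_AE)
      \<comment> \<open>The half-open interval may contain its endpoint \<open>a\<close>, which is
        outside the open component but forms a null set.\<close>
      show "AE m in mOmega. rep_l2 Z m * indicator {x..<y} m = c * indicator {x..<y} m"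
        using c AE_mOmega_neq[of a] by eventually_elim (use that in \<open>auto split: split_indicator\<close>)
    qed measurable
    also have "\<dots> = c * measure lborel ({x..<y} \<inter> Omega)"
      by (simp add: mOmega_def Omega_def measure_restrict_space)
    also have "measure lborel ({x..<y} \<inter> Omega) = measure lborel ({x<..<y})"
      by (rule measure_eq_AE) (use AE_lborel_singleton[of x] xy in \<open>auto simp: Omega_def elim!: eventually_mono\<close>)
    finally show ?thesis using that by simp
  qed
  \<comment> \<open>An endpoint may be 0 or 1 and so lie outside \<open>Omega\<close>; then
    \<open>zero\<close> or \<open>inner_step_1\<close> replaces \<open>out\<close>.\<close>
  have end_le: "inner Z (step a) \<le> 0" "inner Z (step b) \<le> 0"
    using a b out[of a] out[of b] zero ab p01 inner_step_1[of Z]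
    by (cases "a = 0"; cases "b = 1"; force simp: Omega_def)+
  have "(b - a) * inner Z (step p) = (p - a) * inner Z (step b) + (b - p) * inner Z (step a)"
  proof -
    have "(b - p) * (inner Z (step a) - inner Z (step p)) = (p - a) * (inner Z (step p) - inner Z (step b))"
      using int[of a p] int[of p b] ab by simp
    then show ?thesis by (simp add: algebra_simps)
  qed
  also have "\<dots> \<le> 0"
    using ab end_le by (intro add_nonpos_nonpos mult_nonneg_nonpos) auto
  finally show ?thesis using ab by (simp add: mult_le_0_iff)
qed (use out p in auto)

section \<open>Polar cone and subdifferential\<close>

lemma step_0: "step 0 = abs_l2 (\<lambda>_. 1)"
  unfolding step_def
proof (rule abs_l2_eqI)
  show "AE m in mOmega. indicat_real {0..<1} m = 1"
    by (rule AE_I2) (auto simp: Omega_def)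
qed (auto simp: sq_integrable_indicator sq_integrable_const)

text \<open>Turns a sum of superlevel indicators into a clipped floor; for negative \<open>y\<close>
  both sides are 0, on the right through \<open>nat\<close>.\<close>

lemma sum_of_bool_le_real:
  "(\<Sum>k\<in>{1..N}. of_bool (real k \<le> y)) = real (min N (nat \<lfloor>y\<rfloor>))"
proof -
  have "real k \<le> y \<longleftrightarrow> k \<le> nat \<lfloor>y\<rfloor>" if "1 \<le> k" for k
    using that by linarith
  then have "{k \<in> {1..N}. real k \<le> y} = {1..min N (nat \<lfloor>y\<rfloor>)}"
    by auto
  then show ?thesis
    by (simp add: of_bool_def sum.If_cases Int_def)
qed

text \<open>A nondecreasing function is the limit of combinations of its superlevel sets, which are the
  intervals \<open>{p..<1}\<close> up to null sets.\<close>

lemma inner_nonpos_if_step: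
  assumes nonpos: "\<And>p. p \<in> Omega \<Longrightarrow> inner Z (step p) \<le> 0" and zero: "inner Z (step 0) = 0"
    and Y: "Y \<in> K"
  shows "inner Z Y \<le> 0"
proof -
  define f where "f = version Y"
  have f: "sq_integrable f" "abs_l2 f = Y" "mono_on Omega f"
    using Y by (auto simp: f_def sq_integrable_version abs_l2_version mono_on_version)
  have [measurable]: "f \<in> borel_measurable mOmega" using f(1) by (simp add: sq_integrable_def)
  have intZ: "integrable mOmega (rep_l2 Z)"
    by (rule sq_integrable_imp_integrable[OF sq_integrable_rep])
  have meanZ: "(\<integral>m. rep_l2 Z m \<partial>mOmega) = 0"
    using zero by (simp add: step_0 inner_abs_l2_right sq_integrable_const)
  have intb: "integrable mOmega (\<lambda>m. rep_l2 Z m * of_bool (c \<le> f m))" for c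
    by (rule Bochner_Integration.integrable_bound[OF intZ]) auto
  have super: "(\<integral>m. rep_l2 Z m * of_bool (c \<le> f m) \<partial>mOmega) \<le> 0" for c
  proof -
    \<comment> \<open>Inserting 1 keeps the set nonempty: if the level \<open>c\<close> is never
      reached then \<open>p = 1\<close>, and the pairing with \<open>step 1\<close> is 0.\<close>
    let ?S = "insert 1 {m \<in> Omega. c \<le> f m}"
    define p where "p = Inf ?S"
    have bdd: "bdd_below ?S" by (auto intro!: bdd_belowI[of _ 0] simp: Omega_def)
    have p: "0 \<le> p" "p \<le> 1"
      unfolding p_def using bdd by (auto intro!: cInf_greatest cInf_lower simp: Omega_def)
    have "of_bool (c \<le> f m) = indicat_real {p..<1} m" if m: "m \<in> Omega" "m \<noteq> p" for m
    proof (cases "m < p")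
      case True
      then have "\<not> c \<le> f m"
        using cInf_lower[OF _ bdd, of m] m unfolding p_def by auto
      then show ?thesis using True by simp
    next
      case False
      then have "Inf ?S < m" using m by (simp add: p_def)
      then obtain x where "x \<in> ?S" "x < m" by (auto simp: cInf_less_iff[OF _ bdd])
      then have "x \<in> Omega" "c \<le> f x" using m by (auto simp: Omega_def)
      then have "c \<le> f m" using mono_onD[OF f(3), of x m] m \<open>x < m\<close> by auto
      then show ?thesis using False m by (simp add: Omega_def)
    qed
    note eq = this
    have "AE m in mOmega. rep_l2 Z m * of_bool (c \<le> f m) = rep_l2 Z m * indicator {p..<1} m"
      using AE_mOmega_neq[of p] AE_space by eventually_elim (simp add: eq)
    then have "(\<integral>m. rep_l2 Z m * of_bool (c \<le> f m) \<partial>mOmega) = inner Z (step p)"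
      unfolding inner_step by (intro integral_cong_AE) auto
    moreover have "inner Z (step p) \<le> 0"
      using p nonpos[of p] zero inner_step_1[of Z] by (cases "p = 0 \<or> p = 1") (auto simp: Omega_def)
    ultimately show ?thesis by simp
  qed
  \<comment> \<open>With \<open>n = Suc i\<close>, this is \<open>f\<close> clipped to
    \<open>{-n..n}\<close> and rounded down to a grid of mesh \<open>1 / n\<close>. It is a positive
    combination of superlevel indicators minus the constant \<open>n\<close>, and constants vanish
    against \<open>Z\<close> because \<open>Z\<close> has mean zero.\<close>
  define F where "F i m = (\<Sum>k\<in>{1..2 * Suc i * Suc i}. of_bool (real k / Suc i - Suc i \<le> f m)) / Suc i - Suc i" for i m
  have F_eq: "F i m = real (min (2 * Suc i * Suc i) (nat \<lfloor>Suc i * (f m + Suc i)\<rfloor>)) / Suc i - Suc i" for i m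
  proof -
    have "real k / Suc i - Suc i \<le> f m \<longleftrightarrow> real k \<le> Suc i * (f m + Suc i)" for k
      by (simp add: field_simps)
    then show ?thesis unfolding F_def sum_of_bool_le_real[symmetric] by simp
  qed
  have F_bound: "\<bar>F i m\<bar> \<le> \<bar>f m\<bar> + 1"
    and F_close: "\<bar>f m\<bar> \<le> Suc i \<Longrightarrow> \<bar>F i m - f m\<bar> \<le> 1 / Suc i" for i m
  proof -
    define n where "n = real (Suc i)"
    define y where "y = n * (f m + n)"
    have n: "n \<ge> 1" by (simp add: n_def)
    have FF: "F i m = min (2 * n * n) (real (nat \<lfloor>y\<rfloor>)) / n - n"
      unfolding F_eq n_def y_def by (simp only: of_nat_min of_nat_mult of_nat_numeral)
    have close: "\<bar>F i m - f m\<bar> \<le> 1 / n" if fm: "\<bar>f m\<bar> \<le> n"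
    proof -
      have y: "0 \<le> y" "y \<le> 2 * n * n"
        using fm n mult_left_mono[of "f m" n n] mult_nonneg_nonneg[of n "f m + n"]
        by (auto simp: y_def algebra_simps)
      then have "real (nat \<lfloor>y\<rfloor>) = of_int \<lfloor>y\<rfloor>" by simp
      moreover have "of_int \<lfloor>y\<rfloor> \<le> y" "y - 1 < of_int \<lfloor>y\<rfloor>" by linarith+
      moreover from this y have "of_int \<lfloor>y\<rfloor> \<le> 2 * n * n" by linarith
      ultimately have "F i m = of_int \<lfloor>y\<rfloor> / n - n"
        by (simp add: FF min.absorb2)
      moreover have "f m = y / n - n" using n by (simp add: y_def)
      ultimately have "F i m - f m = (of_int \<lfloor>y\<rfloor> - y) / n" by (simp add: diff_divide_distrib)
      moreover have "\<bar>of_int \<lfloor>y\<rfloor> - y\<bar> \<le> 1" by linarith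
      ultimately show ?thesis using n by (simp add: divide_right_mono)
    qed
    then show "\<bar>f m\<bar> \<le> Suc i \<Longrightarrow> \<bar>F i m - f m\<bar> \<le> 1 / Suc i" by (simp add: n_def)
    show "\<bar>F i m\<bar> \<le> \<bar>f m\<bar> + 1"
    proof (cases "\<bar>f m\<bar> \<le> n")
      case True
      have "1 / n \<le> 1" using n by simp
      with close[OF True] show ?thesis by linarith
    next
      case False
      have "F i m \<le> 2 * n * n / n - n" unfolding FF using n
        by (intro diff_right_mono divide_right_mono) auto
      moreover have "0 / n - n \<le> F i m" unfolding FF using n
        by (intro diff_right_mono divide_right_mono) auto
      ultimately have "\<bar>F i m\<bar> \<le> n" using n by simp
      then show ?thesis using False by linarith
    qed
  qed
  have "(\<lambda>i. \<integral>m. rep_l2 Z m * F i m \<partial>mOmega) \<longlonglongrightarrow> (\<integral>m. rep_l2 Z m * f m \<partial>mOmega)"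
  proof (rule integral_dominated_convergence[where w = "\<lambda>m. \<bar>rep_l2 Z m\<bar> * (\<bar>f m\<bar> + 1)"])
    show "(\<lambda>m. rep_l2 Z m * F i m) \<in> borel_measurable mOmega" for i
      unfolding F_def by measurable
    show "integrable mOmega (\<lambda>m. \<bar>rep_l2 Z m\<bar> * (\<bar>f m\<bar> + 1))"
      by (intro sq_integrable_mult sq_integrable_add sq_integrable_abs sq_integrable_rep f sq_integrable_const)
    show "AE m in mOmega. norm (rep_l2 Z m * F i m) \<le> \<bar>rep_l2 Z m\<bar> * (\<bar>f m\<bar> + 1)" for i
      using F_bound by (intro AE_I2) (auto simp: abs_mult intro!: mult_left_mono)
    have "(\<lambda>i. F i m) \<longlonglongrightarrow> f m" for m
    proof -
      obtain n0 :: nat where n0: "\<bar>f m\<bar> \<le> n0" using real_arch_simple by blast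
      have "(\<lambda>i. F i m - f m) \<longlonglongrightarrow> 0"
      proof (rule Lim_null_comparison)
        show "\<forall>\<^sub>F i in sequentially. norm (F i m - f m) \<le> 1 / Suc i"
          using eventually_ge_at_top[of n0] by eventually_elim (use n0 F_close in auto)
        show "(\<lambda>i. 1 / real (Suc i)) \<longlonglongrightarrow> 0" by (rule LIMSEQ_Suc[OF lim_1_over_n])
      qed
      then show ?thesis by (simp add: LIM_zero_iff)
    qed
    then show "AE m in mOmega. (\<lambda>i. rep_l2 Z m * F i m) \<longlonglongrightarrow> rep_l2 Z m * f m"
      by (intro AE_I2 tendsto_intros)
  qed measurable
  moreover have "(\<integral>m. rep_l2 Z m * F i m \<partial>mOmega) \<le> 0" for i
  proof -
    define N where "N = 2 * Suc i * Suc i"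
    define h where "h k m = rep_l2 Z m * of_bool (real k / Suc i - Suc i \<le> f m)" for k m
    have h: "integrable mOmega (h k)" "(\<integral>m. h k m \<partial>mOmega) \<le> 0" for k
      unfolding h_def[abs_def] by (rule intb super)+
    have "rep_l2 Z m * F i m = (\<Sum>k\<in>{1..N}. h k m) / Suc i - Suc i * rep_l2 Z m" for m
      unfolding F_def N_def h_def sum_distrib_left[symmetric] by (simp only: right_diff_distrib times_divide_eq_right mult.commute)
    then have "(\<integral>m. rep_l2 Z m * F i m \<partial>mOmega) =
        (\<integral>m. (\<Sum>k\<in>{1..N}. h k m) / Suc i - Suc i * rep_l2 Z m \<partial>mOmega)"
      by (simp only:)
    also have "\<dots> = (\<Sum>k\<in>{1..N}. \<integral>m. h k m \<partial>mOmega) / Suc i"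
      using h(1) intZ meanZ
      by (subst Bochner_Integration.integral_diff) (auto simp: Bochner_Integration.integral_sum)
    also have "\<dots> \<le> 0"
      by (intro divide_nonpos_pos sum_nonpos h) auto
    finally show ?thesis .
  qed
  ultimately have "(\<integral>m. rep_l2 Z m * f m \<partial>mOmega) \<le> 0"
    by (intro LIMSEQ_le_const2) auto
  then show ?thesis
    using inner_abs_l2_right[OF f(1), of Z] f(2) by simp
qed

text \<open>All tail integrals of \<open>Z\<close> vanish, so its positive and negative parts are
  densities of finite measures that agree on every half-line \<open>{x<..}\<close>. The measures
  coincide, hence so do the densities.\<close>

lemma eq_0_if_inner_step_0:
  assumes orth: "\<And>p. p \<in> Omega \<Longrightarrow> inner Z (step p) = 0" and zero: "inner Z (step 0) = 0"
  shows "Z = 0"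
proof -
  define v where "v m = indicator Omega m * rep_l2 Z m" for m
  have Om: "Omega \<in> sets lborel" by (simp add: Omega_def)
  have int: "integrable lborel v"
    using sq_integrable_imp_integrable[OF sq_integrable_rep[of Z]] Om
    by (simp add: mOmega_def integrable_restrict_space v_def[abs_def])
  have [measurable]: "v \<in> borel_measurable borel" using int by auto
  have tail: "(\<integral>m. v m * indicator {x<..} m \<partial>lborel) = 0" for x
  proof -
    \<comment> \<open>Clamping \<open>x\<close> to the unit interval reduces half-lines that start
      outside \<open>Omega\<close> to \<open>step 0\<close> or \<open>step 1\<close>.\<close>
    define p where "p = max 0 (min x 1)"
    have "(\<integral>m. v m * indicator {x<..} m \<partial>lborel) = (\<integral>m. rep_l2 Z m * indicator {x<..} m \<partial>mOmega)"
      using Om by (simp add: mOmega_def integral_restrict_space v_def mult.assoc)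
    also have "\<dots> = inner Z (step p)"
      unfolding inner_step
    proof (rule integral_cong_AE)
      show "AE m in mOmega. rep_l2 Z m * indicator {x<..} m = rep_l2 Z m * indicator {p..<1} m"
        using AE_mOmega_neq[of p] AE_space
        by eventually_elim (auto simp: p_def Omega_def split: split_indicator)
    qed measurable
    also have "\<dots> = 0"
    proof -
      have "p = 0 \<or> p = 1 \<or> p \<in> Omega" by (auto simp: p_def Omega_def)
      then show ?thesis using orth zero inner_step_1[of Z] by blast
    qed
    finally show ?thesis .
  qed
  let ?P = "\<lambda>m. max 0 (v m)" and ?N = "\<lambda>m. max 0 (- v m)"
  have intPN: "integrable lborel ?P" "integrable lborel ?N"
    using int by auto
  have em: "emeasure (density lborel (\<lambda>m. ennreal (h m))) {x<..} = ennreal (\<integral>m. h m * indicator {x<..} m \<partial>lborel)"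
    if h: "integrable lborel h" "\<And>m. 0 \<le> h m" for h :: "real \<Rightarrow> real" and x
  proof -
    have "integrable lborel (\<lambda>m. h m * indicator {x<..} m)"
      using h by (intro integrable_real_mult_indicator) auto
    then have "(\<integral>\<^sup>+ m. ennreal (h m * indicator {x<..} m) \<partial>lborel) = ennreal (\<integral>m. h m * indicator {x<..} m \<partial>lborel)"
      using h(2) by (intro nn_integral_eq_integral) auto
    moreover have "ennreal (h m * indicator {x<..} m) = ennreal (h m) * indicator {x<..} m" for m
      by (auto split: split_indicator)
    ultimately show ?thesis
      using h(1) by (subst emeasure_density) auto
  qed
  have "density lborel (\<lambda>m. ennreal (?P m)) = density lborel (\<lambda>m. ennreal (?N m))"
  proof (rule measure_eqI_lessThan)
    fix x :: real
    have i: "integrable lborel (\<lambda>m. ?P m * indicator {x<..} m)" "integrable lborel (\<lambda>m. ?N m * indicator {x<..} m)"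
      using intPN by (auto intro!: integrable_real_mult_indicator)
    have "(\<integral>m. ?P m * indicator {x<..} m \<partial>lborel) - (\<integral>m. ?N m * indicator {x<..} m \<partial>lborel)
        = (\<integral>m. v m * indicator {x<..} m \<partial>lborel)"
      by (subst Bochner_Integration.integral_diff[OF i, symmetric])
        (auto intro!: Bochner_Integration.integral_cong simp: max_def split: split_indicator)
    then have "(\<integral>m. ?P m * indicator {x<..} m \<partial>lborel) = (\<integral>m. ?N m * indicator {x<..} m \<partial>lborel)"
      using tail by simp
    then show "emeasure (density lborel (\<lambda>m. ennreal (?P m))) {x<..} = emeasure (density lborel (\<lambda>m. ennreal (?N m))) {x<..}"
      by (simp add: em intPN)
    show "emeasure (density lborel (\<lambda>m. ennreal (?P m))) {x<..} < \<infinity>"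
      by (simp add: em intPN)
  qed auto
  then have "AE m in lborel. ennreal (?P m) = ennreal (?N m)"
    by (intro sigma_finite_measure.density_unique[OF sigma_finite_lborel]) auto
  then have "AE m in lborel. m \<in> Omega \<longrightarrow> rep_l2 Z m = 0"
    by eventually_elim (auto simp: v_def max_def split: if_splits)
  then have "AE m in mOmega. rep_l2 Z m = 0" by (simp add: AE_mOmega_iff)
  then have "abs_l2 (rep_l2 Z) = abs_l2 (\<lambda>_. 0)"
    by (intro abs_l2_eqI sq_integrable_rep sq_integrable_const)
  then show ?thesis by (simp add: abs_rep_l2 zero_l2_def)
qed

lemma const_in_K: "abs_l2 (\<lambda>_. c) \<in> K"
  by (rule K_I) (auto simp: sq_integrable_const mono_on_def)

text \<open>Constants of both signs lie in \<open>K\<close>.\<close>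

lemma inner_step_0_if_subdiff_K:
  assumes "X \<in> K" "W \<in> subdiff_K X"
  shows "inner W (step 0) = 0"
proof -
  have "inner W (abs_l2 (\<lambda>_. c)) = c * inner W (step 0)" for c
    using abs_l2_scale[OF sq_integrable_const[of 1], of c] by (simp add: step_0)
  moreover have "inner W (abs_l2 (\<lambda>_. c)) \<le> 0" for c
    using assms const_in_K by (auto simp: subdiff_K_iff)
  ultimately have "1 * inner W (step 0) \<le> 0" "(-1) * inner W (step 0) \<le> 0" by metis+
  then show ?thesis by simp
qed

text \<open>If \<open>T\<close> and \<open>x \<mapsto> x - T x\<close> are both nondecreasing, then \<open>T \<circ> X\<close> and \<open>X - T \<circ> X\<close> lie in \<open>K\<close>
  and add up to \<open>X\<close>, which is orthogonal to \<open>W\<close>.\<close>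

lemma inner_comp_version_eq_0:
  assumes X: "X \<in> K" and W: "W \<in> subdiff_K X"
    and T: "mono T" "mono (\<lambda>x. x - T x)" "continuous_on UNIV T"
    and sq: "sq_integrable (\<lambda>m. T (version X m))"
  shows "inner W (abs_l2 (\<lambda>m. T (version X m))) = 0"
proof -
  have sq': "sq_integrable (\<lambda>m. version X m - T (version X m))"
    using X sq by (intro sq_integrable_diff sq_integrable_version)
  have "abs_l2 (\<lambda>m. T (version X m)) \<in> K"
    using X T sq by (intro comp_version_in_K)
  moreover have "abs_l2 (\<lambda>m. version X m - T (version X m)) \<in> K"
    using X T sq' by (intro comp_version_in_K[of X "\<lambda>x. x - T x"]) (auto intro!: continuous_intros)
  moreover have "abs_l2 (\<lambda>m. version X m - T (version X m)) = X - abs_l2 (\<lambda>m. T (version X m))"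
    using X sq by (simp add: abs_l2_diff sq_integrable_version abs_l2_version)
  ultimately have "inner W (abs_l2 (\<lambda>m. T (version X m))) \<le> 0"
      "inner W (X - abs_l2 (\<lambda>m. T (version X m))) \<le> 0" "inner W X = 0"
    using W X by (auto simp: subdiff_K_iff)
  then show ?thesis by (simp add: inner_diff_right)
qed

text \<open>Outside \<open>Omega_const X\<close> the function \<open>X\<close> is strict on at least
  one side of \<open>p\<close>, so \<open>step p\<close> is a limit of steep ramps composed with
  \<open>X\<close>. Each ramp is a multiple of a map covered by
  \<open>inner_comp_version_eq_0\<close>.\<close>

lemma inner_step_eq_0_if_subdiff_K:
  assumes X: "X \<in> K" and W: "W \<in> subdiff_K X" and p: "p \<in> Omega - Omega_const X"
  shows "inner W (step p) = 0"
proof -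
  define f where "f = version X"
  have f: "sq_integrable f" "mono_on Omega f"
    using X by (auto simp: f_def sq_integrable_version mono_on_version)
  have [measurable]: "f \<in> borel_measurable mOmega" using f(1) by (simp add: sq_integrable_def)
  have fle: "f x \<le> f y" if "x \<in> Omega" "y \<in> Omega" "x \<le> y" for x y
    using mono_onD[OF f(2)] that by blast
  \<comment> \<open>Otherwise \<open>X\<close> would be flat from some \<open>x < p\<close> to some
    \<open>y > p\<close>, placing \<open>p\<close> in \<open>Omega_const X\<close>.\<close>
  have "(\<forall>x\<in>Omega. x < p \<longrightarrow> f x < f p) \<or> (\<forall>x\<in>Omega. p < x \<longrightarrow> f p < f x)"
  proof (rule ccontr)
    assume "\<not> ?thesis"
    then obtain x y where xy: "x \<in> Omega" "x < p" "f p \<le> f x" "y \<in> Omega" "p < y" "f y \<le> f p"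
      by (auto simp: not_less)
    define e where "e = min (p - x) (y - p)"
    have e: "e > 0" "{p - e<..<p + e} \<subseteq> {x..y}" using xy by (auto simp: e_def)
    have "{x..y} \<subseteq> Omega" using xy by (auto simp: Omega_def)
    then have sub: "{p - e<..<p + e} \<subseteq> Omega" using e(2) by blast
    have "f m = f p" if "m \<in> {p - e<..<p + e}" for m
    proof -
      have "m \<in> Omega" "x \<le> m" "m \<le> y" using that e(2) sub by auto
      then show ?thesis using fle[of x m] fle[of m y] xy by linarith
    qed
    then have "f constant_on {p - e<..<p + e}" unfolding constant_on_def by blast
    then have "p \<in> Omega_const X"
      using e(1) sub p by (auto simp: Omega_const_def f_def)
    then show False using p by simp
  qed
  \<comment> \<open>\<open>s\<close> is the limit value assigned to the level \<open>f p\<close>: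
    with strictness on the left, points at that level are not left of \<open>p\<close> and must get
    1; with strictness on the right they are not right of \<open>p\<close> and must get 0.\<close>
  then obtain s :: real where s: "s \<in> {0, 1}"
    and strict: "s = 1 \<Longrightarrow> \<forall>x\<in>Omega. x < p \<longrightarrow> f x < f p" "s = 0 \<Longrightarrow> \<forall>x\<in>Omega. p < x \<longrightarrow> f p < f x"
    by (metis insertI1 insertI2 singletonI zero_neq_one)
  \<comment> \<open>A ramp of slope 1 and height \<open>1 / Suc n\<close>. Slope at most 1 makes
    \<open>x - T n x\<close> nondecreasing; multiplication by \<open>Suc n\<close> restores height 1
    afterwards.\<close>
  define T where "T n x = max 0 (min (x - f p + s / Suc n) (1 / Suc n))" for n x
  have T01: "0 \<le> T n x" "T n x \<le> 1 / Suc n" for n x by (auto simp: T_def)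
  have meas: "(\<lambda>m. T n (f m)) \<in> borel_measurable mOmega" for n unfolding T_def by measurable
  have sq: "sq_integrable (\<lambda>m. T n (f m))" for n
    by (rule sq_integrable_dominated[OF meas sq_integrable_const[of "1 / Suc n"]])
      (use T01 in \<open>auto simp: abs_of_nonneg\<close>)
  have orth: "inner W (abs_l2 (\<lambda>m. Suc n * T n (f m))) = 0" for n
  proof -
    have "inner W (abs_l2 (\<lambda>m. T n (version X m))) = 0"
    proof (rule inner_comp_version_eq_0[OF X W])
      show "mono (T n)" "mono (\<lambda>x. x - T n x)" by (auto simp: T_def mono_def max_def min_def)
      show "continuous_on UNIV (T n)" unfolding T_def by (intro continuous_intros)
    qed (use sq in \<open>simp add: f_def\<close>)
    then show ?thesis by (subst abs_l2_scale[OF sq]) (simp add: f_def)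
  qed
  have "(\<lambda>n. \<integral>m. rep_l2 W m * (Suc n * T n (f m)) \<partial>mOmega) \<longlonglongrightarrow> (\<integral>m. rep_l2 W m * indicator {p..<1} m \<partial>mOmega)"
  proof (rule integral_dominated_convergence[where w = "\<lambda>m. \<bar>rep_l2 W m\<bar>"])
    show "(\<lambda>m. rep_l2 W m * (Suc n * T n (f m))) \<in> borel_measurable mOmega" for n
      using meas[of n] by measurable
    show "integrable mOmega (\<lambda>m. \<bar>rep_l2 W m\<bar>)"
      by (intro sq_integrable_imp_integrable sq_integrable_abs sq_integrable_rep)
    show "AE m in mOmega. norm (rep_l2 W m * (Suc n * T n (f m))) \<le> \<bar>rep_l2 W m\<bar>" for n
    proof (rule AE_I2)
      fix m
      have "\<bar>Suc n * T n (f m)\<bar> \<le> 1"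
        using T01[of n "f m"] by (simp add: field_simps abs_mult)
      then show "norm (rep_l2 W m * (Suc n * T n (f m))) \<le> \<bar>rep_l2 W m\<bar>"
        by (simp add: abs_mult mult_left_le del: of_nat_Suc)
    qed
    have "\<forall>\<^sub>F n in sequentially. Suc n * T n (f m) = indicator {p..<1} m" if m: "m \<in> Omega" "m \<noteq> p" for m
    proof -
      have ST: "Suc n * T n (f m) = max 0 (min (Suc n * (f m - f p) + s) 1)" for n
        by (simp add: T_def max_mult_distrib_left min_mult_distrib_left algebra_simps del: of_nat_Suc)
      consider "f m = f p" | "f p < f m" | "f m < f p" by linarith
      then show ?thesis
      proof cases
        case 1
        then have "\<not> m < p" if "s = 1" using strict(1)[OF that] m by force
        moreover have "\<not> p < m" if "s = 0" using 1 strict(2)[OF that] m by force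
        ultimately have "s = indicator {p..<1} m"
          using s m p by (auto simp: Omega_def)
        moreover have "max 0 (min s 1) = s" using s by auto
        ultimately show ?thesis unfolding ST by (simp add: 1)
      next
        case 2
        then have "p < m" using fle[of m p] m p by force
        obtain n0 :: nat where n0: "1 / (f m - f p) \<le> n0" using real_arch_simple by blast
        have "\<forall>\<^sub>F n in sequentially. n0 \<le> n" by (rule eventually_ge_at_top)
        then show ?thesis
        proof eventually_elim
          case (elim n)
          have "1 \<le> n0 * (f m - f p)" using n0 2 by (simp add: field_simps)
          also have "\<dots> \<le> Suc n * (f m - f p)" using elim 2 by (intro mult_right_mono) auto
          finally have "1 \<le> Suc n * (f m - f p) + s" using s by auto
          then show ?case unfolding ST using \<open>p < m\<close> m by (simp add: Omega_def)
        qed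
      next
        case 3
        then have "m < p" using fle[of p m] m p by force
        obtain n0 :: nat where n0: "1 / (f p - f m) \<le> n0" using real_arch_simple by blast
        have "\<forall>\<^sub>F n in sequentially. n0 \<le> n" by (rule eventually_ge_at_top)
        then show ?thesis
        proof eventually_elim
          case (elim n)
          have "1 \<le> n0 * (f p - f m)" using n0 3 by (simp add: field_simps)
          also have "\<dots> \<le> Suc n * (f p - f m)" using elim 3 by (intro mult_right_mono) auto
          finally have "Suc n * (f m - f p) + s \<le> 0" using s by (auto simp: algebra_simps)
          then show ?case unfolding ST using \<open>m < p\<close> by simp
        qed
      qed
    qed
    then have "(\<lambda>n. rep_l2 W m * (Suc n * T n (f m))) \<longlonglongrightarrow> rep_l2 W m * indicator {p..<1} m"
      if "m \<in> Omega" "m \<noteq> p" for m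
      using that by (intro tendsto_mult_left tendsto_eventually) auto
    then show "AE m in mOmega. (\<lambda>n. rep_l2 W m * (Suc n * T n (f m))) \<longlonglongrightarrow> rep_l2 W m * indicator {p..<1} m"
      using AE_mOmega_neq[of p] AE_space by (auto elim!: eventually_elim2)
  qed measurable
  moreover have "(\<integral>m. rep_l2 W m * (Suc n * T n (f m)) \<partial>mOmega) = 0" for n
    using orth[of n] inner_abs_l2_right[OF sq_integrable_scale[OF sq], of W "Suc n" n] by simp
  ultimately have "(\<lambda>n::nat. 0::real) \<longlonglongrightarrow> inner W (step p)"
    by (simp add: inner_step)
  then show ?thesis by (simp add: tendsto_const_iff)
qed

text \<open>Let \<open>Z\<close> be the projection of \<open>W\<close> onto \<open>H X\<close>. Its
  pairings with steps vanish outside \<open>Omega_const X\<close>, as those of \<open>W\<close> do,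
  and by \<open>inner_step_nonpos\<close> for \<open>Z\<close> and \<open>- Z\<close> they vanish
  inside too, so \<open>Z = 0\<close>.\<close>

lemma inner_eq_0_if_subdiff_K:
  assumes X: "X \<in> K" and W: "W \<in> subdiff_K X" and U: "U \<in> H X"
  shows "inner W U = 0"
proof -
  obtain Z where Z: "Z \<in> H X" and orth: "\<And>U. U \<in> H X \<Longrightarrow> inner (W - Z) U = 0"
    using orthogonal_projection_exists[OF subspace_H closed_H] by metis
  have Z_out: "inner Z (step p) = 0" if "p \<in> Omega - Omega_const X" for p
    using orth[OF step_in_H, of p] inner_step_eq_0_if_subdiff_K[OF X W that] that
    by (simp add: inner_diff_left)
  have Z_0: "inner Z (step 0) = 0"
  proof -
    have "0 \<notin> Omega_const X" using Omega_const_subset[of X] by (auto simp: Omega_def)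
    then show ?thesis
      using orth[OF step_in_H, of 0] inner_step_0_if_subdiff_K[OF X W] by (simp add: inner_diff_left)
  qed
  have mZ: "- Z \<in> H X" using subspace_neg[OF subspace_H Z] .
  have "inner Z (step p) = 0" if p: "p \<in> Omega" for p
    using inner_step_nonpos[OF Z _ _ p] inner_step_nonpos[OF mZ _ _ p] Z_out Z_0
    by (intro order_antisym) (auto simp: inner_minus_left)
  then have "Z = 0" using Z_0 by (rule eq_0_if_inner_step_0)
  then show ?thesis using orth[OF U] by simp
qed

text \<open>Applied with \<open>X\<close> an earlier and \<open>Y\<close> a later state. In
  \<open>A - B = (P - B) - (P - A)\<close> the second term vanishes against \<open>H X\<close>,
  which contains \<open>Y\<close> and the steps at points outside \<open>Omega_const X\<close>; the
  remaining steps follow from \<open>A - B \<in> H X\<close>.\<close>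

lemma subdiff_K_diff:
  assumes XY: "X \<in> K" "Y \<in> K" "Omega_const X \<subseteq> Omega_const Y"
    and A: "A \<in> H X" "P - A \<in> subdiff_K X" and B: "B \<in> H Y" "P - B \<in> subdiff_K Y"
  shows "A - B \<in> subdiff_K Y"
proof -
  have split: "inner (A - B) U = inner (P - B) U - inner (P - A) U" for U
    by (simp add: inner_diff_left)
  have AB: "A - B \<in> H X"
    using A(1) B(1) H_antimono[OF XY(3)] by (intro subspace_diff subspace_H) auto
  have zero: "inner (A - B) (step 0) = 0"
    unfolding split using inner_step_0_if_subdiff_K[OF XY(1) A(2)] inner_step_0_if_subdiff_K[OF XY(2) B(2)] by simp
  have out: "inner (A - B) (step p) \<le> 0" if "p \<in> Omega - Omega_const X" for p
    unfolding split using inner_step_eq_0_if_subdiff_K[OF XY(1) A(2) that] B(2) step_in_K[of p] XY(2)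
    by (simp add: subdiff_K_iff)
  have "inner (A - B) U \<le> 0" if "U \<in> K" for U
    using inner_nonpos_if_step[OF inner_step_nonpos[OF AB out] zero that] zero by simp
  moreover have "inner (A - B) Y = 0"
    unfolding split using B(2) XY(2) inner_eq_0_if_subdiff_K[OF XY(1) A(2)]
      H_antimono[OF XY(3)] K_subset_H[OF XY(2)]
    by (auto simp: subdiff_K_iff)
  ultimately show ?thesis using XY by (simp add: subdiff_K_iff)
qed

section \<open>The alignment force is continuous\<close>

text \<open>Cut \<phi> at a small \<delta>: its integral over \<open>{-\<delta>..\<delta>}\<close>
  is below \<epsilon> by dominated convergence, and beyond \<delta> it is at most
  \<open>\<phi> \<delta>\<close>, which serves as \<open>C\<close>.\<close>

lemma Phi_diff_bounds:
  assumes phi: "comm_protocol \<phi>" and \<epsilon>: "0 < \<epsilon>"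
  obtains C where "0 \<le> C"
    "\<And>a b. a \<le> b \<Longrightarrow> 0 \<le> Phi \<phi> b - Phi \<phi> a \<and> Phi \<phi> b - Phi \<phi> a \<le> \<epsilon> + C * (b - a)"
proof -
  have nonneg: "0 \<le> \<phi> x" for x using phi by (simp add: comm_protocol_def)
  have decr: "\<phi> y \<le> \<phi> x" if "0 < \<bar>x\<bar>" "\<bar>x\<bar> \<le> \<bar>y\<bar>" for x y
    using phi that by (auto simp: comm_protocol_def)
  have loc: "integrable lborel (\<lambda>y. indicator {a..b} y * \<phi> y)" for a b :: real
    using phi by (simp add: comm_protocol_def set_integrable_def)
  have diff: "Phi \<phi> b - Phi \<phi> a = (\<integral>y. indicator {a..b} y * \<phi> y \<partial>lborel)" if "a \<le> b" for a b
  proof -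
    \<comment> \<open>The hull of 0, \<open>a\<close> and \<open>b\<close>, on which integrability
      lets the oriented integrals be added.\<close>
    define l u where "l = min 0 (min a b)" and "u = max 0 (max a b)"
    have lu: "min (ereal 0) (min (ereal a) (ereal b)) = ereal l"
      "max (ereal 0) (max (ereal a) (ereal b)) = ereal u" "l \<le> u"
      by (auto simp: l_def u_def min_def max_def)
    have "set_integrable lborel {l<..<u} \<phi>"
      by (rule set_integrable_subset[of _ "{l..u}"]) (use loc[of l u] in \<open>auto simp: set_integrable_def\<close>)
    then have "interval_lebesgue_integrable lborel (ereal l) (ereal u) \<phi>"
      using \<open>l \<le> u\<close> by (simp add: interval_lebesgue_integrable_def)
    then have "(LBINT x=ereal 0..a. \<phi> x) + (LBINT x=a..b. \<phi> x) = (LBINT x=ereal 0..b. \<phi> x)"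
      unfolding lu(1,2)[symmetric] by (rule interval_integral_sum)
    moreover have "(LBINT x=a..b. \<phi> x) = (\<integral>y. indicator {a..b} y * \<phi> y \<partial>lborel)"
      using that by (simp add: interval_integral_Icc set_lebesgue_integral_def)
    ultimately show ?thesis by (simp add: Phi_def zero_ereal_def)
  qed
  have "(\<lambda>n. \<integral>y. indicator {- (1 / Suc n)..1 / Suc n} y * \<phi> y \<partial>lborel) \<longlonglongrightarrow> (\<integral>y. 0 \<partial>(lborel :: real measure))"
  proof (rule integral_dominated_convergence[where w = "\<lambda>y. indicator {-1..1} y * \<phi> y"])
    show "AE y in lborel. norm (indicator {- (1 / Suc n)..1 / Suc n} y * \<phi> y) \<le> indicator {-1..1} y * \<phi> y" for n
    proof (rule AE_I2)
      fix y :: real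
      have "1 / Suc n \<le> (1::real)" by simp
      then have sub: "y \<in> {- (1 / Suc n)..1 / Suc n} \<Longrightarrow> y \<in> {-1..1}"
        unfolding atLeastAtMost_iff by linarith
      then show "norm (indicator {- (1 / Suc n)..1 / Suc n} y * \<phi> y) \<le> indicator {-1..1} y * \<phi> y"
        using nonneg[of y] sub
        by (cases "y \<in> {- (1 / Suc n)..1 / Suc n}"; cases "y \<in> {-1..1}") (simp_all del: atLeastAtMost_iff)
    qed
    have "(\<lambda>n. indicator {- (1 / Suc n)..1 / Suc n} y * \<phi> y) \<longlonglongrightarrow> 0" if "y \<noteq> 0" for y
    proof (rule tendsto_eventually)
      have "(\<lambda>n. 1 / real (Suc n)) \<longlonglongrightarrow> 0" by (rule LIMSEQ_Suc[OF lim_1_over_n])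
      then have "\<forall>\<^sub>F n in sequentially. 1 / real (Suc n) < \<bar>y\<bar>"
        using that by (intro order_tendstoD(2)) auto
      then show "\<forall>\<^sub>F n in sequentially. indicator {- (1 / Suc n)..1 / Suc n} y * \<phi> y = 0"
        by eventually_elim (auto split: split_indicator)
    qed
    then show "AE y in lborel. (\<lambda>n. indicator {- (1 / Suc n)..1 / Suc n} y * \<phi> y) \<longlonglongrightarrow> 0"
      using AE_lborel_singleton[of 0] by (auto elim: eventually_mono)
  qed (use loc in auto)
  then have "\<forall>\<^sub>F n in sequentially. (\<integral>y. indicator {- (1 / Suc n)..1 / Suc n} y * \<phi> y \<partial>lborel) < \<epsilon>"
    using \<epsilon> by (intro order_tendstoD(2)) auto
  then obtain n :: nat where n: "(\<integral>y. indicator {- (1 / Suc n)..1 / Suc n} y * \<phi> y \<partial>lborel) < \<epsilon>"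
    by (auto simp: eventually_sequentially)
  define \<delta> where "\<delta> = 1 / real (Suc n)"
  have "\<delta> > 0" by (simp add: \<delta>_def)
  show ?thesis
  proof (rule that)
    show "0 \<le> \<phi> \<delta>" by (rule nonneg)
    fix a b :: real assume ab: "a \<le> b"
    have "(\<integral>y. indicator {a..b} y * \<phi> y \<partial>lborel)
        \<le> (\<integral>y. indicator {-\<delta>..\<delta>} y * \<phi> y + indicator {a..b} y * \<phi> \<delta> \<partial>lborel)"
    proof (rule integral_mono)
      fix y :: real
      show "indicator {a..b} y * \<phi> y \<le> indicator {-\<delta>..\<delta>} y * \<phi> y + indicator {a..b} y * \<phi> \<delta>"
        using nonneg[of y] nonneg[of \<delta>] decr[of \<delta> y] \<open>\<delta> > 0\<close>
        by (cases "\<bar>y\<bar> \<le> \<delta>") (auto split: split_indicator)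
    qed (use loc in \<open>auto intro!: Bochner_Integration.integrable_add integrable_mult_left integrable_real_indicator simp: emeasure_lborel_Icc_eq\<close>)
    also have "\<dots> = (\<integral>y. indicator {-\<delta>..\<delta>} y * \<phi> y \<partial>lborel) + \<phi> \<delta> * (b - a)"
      using loc ab by (subst Bochner_Integration.integral_add) auto
    also have "\<dots> \<le> \<epsilon> + \<phi> \<delta> * (b - a)"
      using n by (simp add: \<delta>_def)
    finally show "0 \<le> Phi \<phi> b - Phi \<phi> a \<and> Phi \<phi> b - Phi \<phi> a \<le> \<epsilon> + \<phi> \<delta> * (b - a)"
      using diff[OF ab] nonneg by (auto intro!: Bochner_Integration.integral_nonneg)
  qed
qed

text \<open>\<open>\<Phi>\<close> need not be Lipschitz, since \<open>\<phi>\<close> may be singular at \<open>0\<close>.\<close>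

lemma Phi_almost_Lipschitz:
  assumes phi: "comm_protocol \<phi>" and \<epsilon>: "0 < \<epsilon>"
  obtains C where "0 \<le> C" "\<And>a b. \<bar>Phi \<phi> a - Phi \<phi> b\<bar> \<le> \<epsilon> + C * \<bar>a - b\<bar>"
proof -
  obtain C where C: "0 \<le> C"
    "\<And>a b. a \<le> b \<Longrightarrow> 0 \<le> Phi \<phi> b - Phi \<phi> a \<and> Phi \<phi> b - Phi \<phi> a \<le> \<epsilon> + C * (b - a)"
    using Phi_diff_bounds[OF assms] by metis
  have "\<bar>Phi \<phi> a - Phi \<phi> b\<bar> \<le> \<epsilon> + C * \<bar>a - b\<bar>" for a b
    using C(2)[of a b] C(2)[of b a] by (cases "a \<le> b") (auto simp: abs_if split: if_splits)
  with C(1) that show ?thesis by blast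
qed

lemma mono_Phi:
  assumes "comm_protocol \<phi>"
  shows "mono (Phi \<phi>)"
  using Phi_diff_bounds[OF assms zero_less_one] by (metis diff_ge_0_iff_ge monoI)

text \<open>Linear growth will keep the alignment force of a square-integrable state square
  integrable.\<close>

lemma Phi_linear_bound:
  assumes phi: "comm_protocol \<phi>"
  obtains C where "0 \<le> C" "\<And>x. \<bar>Phi \<phi> x\<bar> \<le> 1 + C * \<bar>x\<bar>"
proof -
  obtain C where C: "0 \<le> C" "\<And>a b. \<bar>Phi \<phi> a - Phi \<phi> b\<bar> \<le> 1 + C * \<bar>a - b\<bar>"
    using Phi_almost_Lipschitz[OF phi zero_less_one] by blast
  have "Phi \<phi> 0 = 0" by (simp add: Phi_def flip: zero_ereal_def)
  then have "\<bar>Phi \<phi> x\<bar> \<le> 1 + C * \<bar>x\<bar>" for x using C(2)[of x 0] by simp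
  with C(1) that show ?thesis by blast
qed

lemma Phi_borel_measurable: "comm_protocol \<phi> \<Longrightarrow> Phi \<phi> \<in> borel_measurable borel"
  by (intro borel_measurable_mono mono_Phi)

section \<open>The alignment force as an element of \<open>l2\<close>\<close>

lemma integrable_Phi_diff:
  assumes phi: "comm_protocol \<phi>" and f: "sq_integrable f"
  shows "integrable mOmega (\<lambda>w. Phi \<phi> (x - f w))"
proof -
  obtain C where C: "0 \<le> C" "\<And>x. \<bar>Phi \<phi> x\<bar> \<le> 1 + C * \<bar>x\<bar>"
    using Phi_linear_bound[OF phi] by blast
  note [measurable] = Phi_borel_measurable[OF phi]
  have [measurable]: "f \<in> borel_measurable mOmega" using f by (simp add: sq_integrable_def)
  show ?thesis
  proof (rule Bochner_Integration.integrable_bound)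
    show "integrable mOmega (\<lambda>w. 1 + C * \<bar>x - f w\<bar>)"
      using sq_integrable_imp_integrable[OF f] by auto
    have "norm (Phi \<phi> (x - f w)) \<le> norm (1 + C * \<bar>x - f w\<bar>)" for w
      using C(1) C(2)[of "x - f w"] by simp
    then show "AE w in mOmega. norm (Phi \<phi> (x - f w)) \<le> norm (1 + C * \<bar>x - f w\<bar>)" by simp
  qed measurable
qed

lemma Phi_conv_law:
  assumes phi: "comm_protocol \<phi>" and X: "X \<in> K"
  shows "Phi_conv \<phi> (law X) x = (\<integral>w. Phi \<phi> (x - version X w) \<partial>mOmega)"
proof -
  note [measurable] = Phi_borel_measurable[OF phi]
  have "version X \<in> borel_measurable mOmega"
    using sq_integrable_version[OF X] by (simp add: sq_integrable_def)
  then show ?thesis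
    unfolding Phi_conv_def law_def by (intro integral_distr) auto
qed

lemma sq_integrable_Phi_conv:
  assumes phi: "comm_protocol \<phi>" and X: "X \<in> K"
  shows "sq_integrable (\<lambda>m. Phi_conv \<phi> (law X) (version X m))"
proof -
  define f where "f = version X"
  have f: "sq_integrable f" using sq_integrable_version[OF X] by (simp add: f_def)
  then have [measurable]: "f \<in> borel_measurable mOmega" by (simp add: sq_integrable_def)
  let ?T = "\<lambda>x. \<integral>w. Phi \<phi> (x - f w) \<partial>mOmega"
  \<comment> \<open>Measurability of the averaged potential comes from its monotonicity.\<close>
  have "mono ?T"
    by (intro monoI integral_mono integrable_Phi_diff phi f monoD[OF mono_Phi[OF phi]]) auto
  then have [measurable]: "?T \<in> borel_measurable borel" by (rule borel_measurable_mono)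
  obtain C where C: "0 \<le> C" "\<And>x. \<bar>Phi \<phi> x\<bar> \<le> 1 + C * \<bar>x\<bar>"
    using Phi_linear_bound[OF phi] by blast
  define B where "B = (\<integral>w. \<bar>f w\<bar> \<partial>mOmega)"
  have B: "0 \<le> B" by (simp add: B_def)
  have bound: "\<bar>?T x\<bar> \<le> 1 + C * \<bar>x\<bar> + C * B" for x
  proof -
    have "\<bar>?T x\<bar> \<le> (\<integral>w. \<bar>Phi \<phi> (x - f w)\<bar> \<partial>mOmega)" by (rule integral_abs_bound)
    also have "\<dots> \<le> (\<integral>w. (1 + C * \<bar>x\<bar>) + C * \<bar>f w\<bar> \<partial>mOmega)"
    proof (rule integral_mono)
      show "integrable mOmega (\<lambda>w. \<bar>Phi \<phi> (x - f w)\<bar>)"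
        by (intro integrable_abs integrable_Phi_diff phi f)
      show "integrable mOmega (\<lambda>w. (1 + C * \<bar>x\<bar>) + C * \<bar>f w\<bar>)"
        using sq_integrable_imp_integrable[OF f] by auto
      fix w
      have "C * \<bar>x - f w\<bar> \<le> C * (\<bar>x\<bar> + \<bar>f w\<bar>)" using C(1) by (intro mult_left_mono) auto
      then show "\<bar>Phi \<phi> (x - f w)\<bar> \<le> (1 + C * \<bar>x\<bar>) + C * \<bar>f w\<bar>"
        using C(2)[of "x - f w"] by (simp add: algebra_simps)
    qed
    also have "\<dots> = 1 + C * \<bar>x\<bar> + C * B"
      using sq_integrable_imp_integrable[OF f]
      by (subst Bochner_Integration.integral_add) (auto simp: B_def)
    finally show ?thesis .
  qed
  have "sq_integrable (\<lambda>m. ?T (f m))"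
  proof (rule sq_integrable_dominated)
    show "sq_integrable (\<lambda>m. (1 + C * B) + C * \<bar>f m\<bar>)"
      by (intro sq_integrable_add sq_integrable_const sq_integrable_scale sq_integrable_abs f)
    show "\<bar>?T (f m)\<bar> \<le> \<bar>(1 + C * B) + C * \<bar>f m\<bar>\<bar>" for m
      using bound[of "f m"] by linarith
  qed measurable
  then show ?thesis by (simp add: Phi_conv_law[OF phi X] f_def)
qed

lemma Phi_rho_in_H:
  assumes "comm_protocol \<phi>" "X \<in> K"
  shows "Phi_rho \<phi> X \<in> H X"
  unfolding Phi_rho_def by (intro comp_version_in_H sq_integrable_Phi_conv assms)

text \<open>The average over \<open>Omega\<close> in \<open>U_field\<close> and the convolution with
  the law in \<open>Phi_rho\<close> agree by change of variables.\<close>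

lemma U_field_eq:
  assumes "comm_protocol \<phi>" "X \<in> K"
  shows "U_field \<phi> Xbar Vbar X = Psi \<phi> Xbar Vbar - Phi_rho \<phi> X"
  using assms by (simp add: U_field_def Phi_rho_def Phi_conv_law)

text \<open>One \<open>C\<close> comes from the displacement at \<open>m\<close>, the other from its
  mean over \<open>w\<close>, which Cauchy-Schwarz bounds by the norm. The constant is uniform in
  both states.\<close>

lemma Phi_rho_almost_Lipschitz:
  assumes phi: "comm_protocol \<phi>" and \<epsilon>: "0 < \<epsilon>"
  obtains C where "0 \<le> C"
    "\<And>X Y. X \<in> K \<Longrightarrow> Y \<in> K \<Longrightarrow> norm (Phi_rho \<phi> X - Phi_rho \<phi> Y) \<le> \<epsilon> + C * norm (X - Y)"
proof -
  obtain C where C: "0 \<le> C" "\<And>a b. \<bar>Phi \<phi> a - Phi \<phi> b\<bar> \<le> \<epsilon> + C * \<bar>a - b\<bar>"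
    using Phi_almost_Lipschitz[OF phi \<epsilon>] by blast
  show ?thesis
  proof (rule that[of "2 * C"])
    fix X Y assume XY: "X \<in> K" "Y \<in> K"
    define f g where "f = version X" and "g = version Y"
    have sq: "sq_integrable f" "sq_integrable g"
      using XY by (auto simp: f_def g_def sq_integrable_version)
    define d where "d m = \<bar>f m - g m\<bar>" for m
    have d: "sq_integrable d" unfolding d_def[abs_def] by (intro sq_integrable_abs sq_integrable_diff sq)
    have XYd: "norm (abs_l2 d) = norm (X - Y)"
    proof -
      have "X - Y = abs_l2 (\<lambda>m. f m - g m)"
        using XY sq by (simp add: abs_l2_diff f_def g_def abs_l2_version)
      then show ?thesis
        unfolding d_def[abs_def] using sq
        by (intro antisym) (auto intro!: norm_abs_l2_mono sq_integrable_abs sq_integrable_diff)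
    qed
    define n where "n = norm (X - Y)"
    let ?F = "\<lambda>X m. Phi_conv \<phi> (law X) (version X m)"
    have Fsq: "sq_integrable (?F X)" "sq_integrable (?F Y)"
      using XY phi by (auto intro: sq_integrable_Phi_conv)
    have pointwise: "\<bar>?F X m - ?F Y m\<bar> \<le> (\<epsilon> + C * n) + C * d m" for m
    proof -
      have "?F X m - ?F Y m = (\<integral>w. Phi \<phi> (f m - f w) - Phi \<phi> (g m - g w) \<partial>mOmega)"
        unfolding Phi_conv_law[OF phi XY(1)] Phi_conv_law[OF phi XY(2)] f_def[symmetric] g_def[symmetric]
        by (intro Bochner_Integration.integral_diff[symmetric] integrable_Phi_diff phi sq)
      then have "\<bar>?F X m - ?F Y m\<bar> \<le> (\<integral>w. \<bar>Phi \<phi> (f m - f w) - Phi \<phi> (g m - g w)\<bar> \<partial>mOmega)"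
        by (simp only: integral_abs_bound)
      also have "\<dots> \<le> (\<integral>w. (\<epsilon> + C * d m) + C * d w \<partial>mOmega)"
      proof (rule integral_mono)
        show "integrable mOmega (\<lambda>w. \<bar>Phi \<phi> (f m - f w) - Phi \<phi> (g m - g w)\<bar>)"
          by (intro integrable_abs Bochner_Integration.integrable_diff integrable_Phi_diff phi sq)
        show "integrable mOmega (\<lambda>w. (\<epsilon> + C * d m) + C * d w)"
          using sq_integrable_imp_integrable[OF d] by auto
        fix w
        have "\<bar>(f m - f w) - (g m - g w)\<bar> \<le> d m + d w" unfolding d_def by linarith
        then have "C * \<bar>(f m - f w) - (g m - g w)\<bar> \<le> C * (d m + d w)"
          using C(1) by (intro mult_left_mono) auto
        then show "\<bar>Phi \<phi> (f m - f w) - Phi \<phi> (g m - g w)\<bar> \<le> (\<epsilon> + C * d m) + C * d w"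
          using C(2)[of "f m - f w" "g m - g w"] by (simp add: algebra_simps)
      qed
      also have "\<dots> = (\<epsilon> + C * d m) + C * (\<integral>w. d w \<partial>mOmega)"
        using sq_integrable_imp_integrable[OF d] by (subst Bochner_Integration.integral_add) auto
      also have "\<dots> \<le> (\<epsilon> + C * d m) + C * n"
        using integral_le_norm_abs_l2[OF d] C(1) by (intro add_left_mono mult_left_mono) (auto simp: XYd n_def)
      finally show ?thesis by (simp add: algebra_simps)
    qed
    have n0: "0 \<le> n" by (simp add: n_def)
    have "Phi_rho \<phi> X - Phi_rho \<phi> Y = abs_l2 (\<lambda>m. ?F X m - ?F Y m)"
      unfolding Phi_rho_def by (rule abs_l2_diff[symmetric]) (rule Fsq)+
    also have "norm \<dots> \<le> norm (abs_l2 (\<lambda>m. (\<epsilon> + C * n) * 1 + C * d m))"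
    proof (rule norm_abs_l2_mono)
      show "\<bar>?F X m - ?F Y m\<bar> \<le> \<bar>(\<epsilon> + C * n) * 1 + C * d m\<bar>" for m
        using order_trans[OF pointwise[of m] abs_ge_self] by simp
    qed (intro sq_integrable_diff sq_integrable_add sq_integrable_scale Fsq d sq_integrable_const)+
    also have "\<dots> = norm ((\<epsilon> + C * n) *\<^sub>R abs_l2 (\<lambda>_. 1) + C *\<^sub>R abs_l2 d)"
      using d by (subst abs_l2_add) (simp_all only: sq_integrable_scale sq_integrable_const abs_l2_scale)
    also have "\<dots> \<le> (\<epsilon> + C * n) * norm (abs_l2 (\<lambda>_. 1)) + C * norm (abs_l2 d)"
      using norm_triangle_ineq[of "(\<epsilon> + C * n) *\<^sub>R abs_l2 (\<lambda>_. 1)" "C *\<^sub>R abs_l2 d"] C(1) \<epsilon> n0 by simp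
    also have "norm (abs_l2 (\<lambda>_. 1)) = 1"
      by (simp add: norm_eq_sqrt_inner inner_abs_l2 sq_integrable_const)
    finally show "norm (Phi_rho \<phi> X - Phi_rho \<phi> Y) \<le> \<epsilon> + 2 * C * norm (X - Y)"
      by (simp add: XYd n_def)
  qed (use C in simp)
qed

lemma continuous_on_Phi_rho:
  assumes phi: "comm_protocol \<phi>"
  shows "continuous_on K (Phi_rho \<phi>)"
  unfolding continuous_on_iff
proof (intro ballI allI impI)
  fix X and e :: real assume X: "X \<in> K" and e: "0 < e"
  obtain C where C: "0 \<le> C" "\<And>X Y. X \<in> K \<Longrightarrow> Y \<in> K \<Longrightarrow>
      norm (Phi_rho \<phi> X - Phi_rho \<phi> Y) \<le> e / 2 + C * norm (X - Y)"
    using Phi_rho_almost_Lipschitz[OF phi, of "e / 2"] e by auto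
  have "dist (Phi_rho \<phi> Y) (Phi_rho \<phi> X) < e" if Y: "Y \<in> K" "dist Y X < e / (2 * (C + 1))" for Y
  proof -
    have "C * norm (Y - X) \<le> (C + 1) * norm (Y - X)" by (intro mult_right_mono) auto
    also have "\<dots> < e / 2" using Y(2) C(1) by (simp add: dist_norm field_simps)
    finally show ?thesis using C(2)[OF Y(1) X] by (simp add: dist_norm)
  qed
  then show "\<exists>d>0. \<forall>Y\<in>K. dist Y X < d \<longrightarrow> dist (Phi_rho \<phi> Y) (Phi_rho \<phi> X) < e"
    using C(1) e by (intro exI[of _ "e / (2 * (C + 1))"]) auto
qed

section \<open>Sticky solutions\<close>

lemma abs_cont_curve_imp_continuous_on:
  assumes "abs_cont_curve X"
  shows "continuous_on {0..} X"
  unfolding continuous_on_iff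
proof (intro ballI allI impI)
  fix t e :: real assume t: "t \<in> {0..}" and e: "0 < e"
  have "0 < t + 1" using t by simp
  note assms[unfolded abs_cont_curve_def, THEN spec, THEN mp, OF this, THEN spec, THEN mp, OF e]
  then obtain \<delta> where \<delta>: "\<delta> > 0" and ac: "\<And>(n::nat) a b.
       (\<forall>i<n. 0 \<le> a i \<and> a i \<le> b i \<and> b i \<le> t + 1) \<and>
       (\<forall>i<n. \<forall>j<n. i \<noteq> j \<longrightarrow> {a i<..<b i} \<inter> {a j<..<b j} = {}) \<and>
       (\<Sum>i<n. b i - a i) < \<delta> \<longrightarrow> (\<Sum>i<n. dist (X (a i)) (X (b i))) < e"
    by blast
  have "dist (X y) (X t) < e" if y: "0 \<le> y" "dist y t < min \<delta> 1" for y
  proof -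
    \<comment> \<open>A single interval with ordered endpoints suffices; \<open>dist y t < 1\<close>
      keeps it below the horizon \<open>t + 1\<close>.\<close>
    have "dist (X (min t y)) (X (max t y)) < e"
      using ac[of 1 "\<lambda>_. min t y" "\<lambda>_. max t y"] t y
      by (auto simp: dist_real_def min_def max_def split: if_splits)
    then show ?thesis by (auto simp: min_def max_def dist_commute split: if_splits)
  qed
  then show "\<exists>d>0. \<forall>y\<in>{0..}. dist y t < d \<longrightarrow> dist (X y) (X t) < e"
    using \<delta> by (intro exI[of _ "min \<delta> 1"]) auto
qed

lemma integral_has_right_derivative:
  fixes f :: "real \<Rightarrow> 'a::banach"
  assumes "continuous_on {a..} f" "a \<le> t"
  shows "((\<lambda>r. integral {a..r} f) has_vector_derivative f t) (at_right t)"
proof -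
  have "continuous_on {a..t + 1} f" by (rule continuous_on_subset[OF assms(1)]) auto
  then have "((\<lambda>r. integral {a..r} f) has_vector_derivative f t) (at t within {a..t + 1})"
    using assms(2) by (intro integral_has_vector_derivative) auto
  then have "((\<lambda>r. integral {a..r} f) has_vector_derivative f t) (at t within {t..t + 1})"
    using assms(2) by (elim has_vector_derivative_within_subset) auto
  then show ?thesis by (simp add: at_within_Icc_at_right)
qed

lemma continuous_on_integral_from:
  fixes f :: "real \<Rightarrow> 'a::banach"
  assumes "continuous_on {a..} f"
  shows "continuous_on {a..} (\<lambda>r. integral {a..r} f)"
  unfolding continuous_on_eq_continuous_within
proof
  fix t assume t: "t \<in> {a..}"
  have "continuous_on {a..t + 1} f" by (rule continuous_on_subset[OF assms]) auto
  then have "continuous_on {a..t + 1} (\<lambda>r. integral {a..r} f)"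
    by (intro indefinite_integral_continuous_1 integrable_continuous_real)
  then have "continuous (at t within {a..t + 1}) (\<lambda>r. integral {a..r} f)"
    using t by (auto simp: continuous_on_eq_continuous_within)
  moreover have "at t within {a..t + 1} = at t within {a..}"
    using t by (intro at_within_nhd[of t "{..<t + 1}"]) auto
  ultimately show "continuous (at t within {a..}) (\<lambda>r. integral {a..r} f)"
    by (simp add: continuous_within)
qed

lemma inner_has_right_derivative:
  fixes f :: "real \<Rightarrow> 'a::real_inner"
  assumes "(f has_vector_derivative D) (at_right t)"
  shows "((\<lambda>r. inner (f r) y) has_real_derivative inner D y) (at_right t)"
  unfolding has_real_derivative_iff_has_vector_derivative
  by (rule bounded_linear.has_vector_derivative[OF bounded_linear_inner_left assms])

lemma inner_self_has_right_derivative: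
  fixes f :: "real \<Rightarrow> 'a::real_inner"
  assumes "(f has_vector_derivative D) (at_right t)"
  shows "((\<lambda>r. inner (f r) (f r) / 2) has_real_derivative inner D (f t)) (at_right t)"
proof -
  have "((\<lambda>r. inner (f r) (f r)) has_real_derivative inner (f t) D + inner D (f t)) (at_right t)"
    unfolding has_real_derivative_iff_has_vector_derivative
    by (rule bounded_bilinear.has_vector_derivative[OF bounded_bilinear_inner assms assms])
  from DERIV_cdivide[OF this, of 2] show ?thesis by (simp add: inner_commute)
qed

text \<open>The part of \<open>D\<close> orthogonal to \<open>C\<close> is orthogonal to every
  difference quotient, hence to \<open>D\<close> and so to itself.\<close>

lemma right_derivative_in_closed_subspace:
  fixes f :: "real \<Rightarrow> 'a::{real_inner,complete_space}"
  assumes der: "(f has_vector_derivative D) (at_right t)"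
    and C: "subspace C" "closed C" and f: "\<And>r. t \<le> r \<Longrightarrow> f r \<in> C"
  shows "D \<in> C"
proof -
  obtain Z where Z: "Z \<in> C" "\<And>z. z \<in> C \<Longrightarrow> inner (D - Z) z = 0"
    using orthogonal_projection_exists[OF C] by metis
  have "((\<lambda>y. (inner (f y) (D - Z) - inner (f t) (D - Z)) / (y - t)) \<longlongrightarrow> inner D (D - Z)) (at_right t)"
    using inner_has_right_derivative[OF der, of "D - Z"] by (simp add: has_field_derivative_iff)
  moreover have "\<forall>\<^sub>F y in at_right t. (inner (f y) (D - Z) - inner (f t) (D - Z)) / (y - t) = 0"
    using eventually_at_right_less[of t]
    by eventually_elim (use Z(2)[OF f] in \<open>simp add: inner_commute\<close>)
  ultimately have "((\<lambda>y. 0) \<longlongrightarrow> inner D (D - Z)) (at_right t)"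
    by (rule Lim_transform_eventually)
  then have "inner D (D - Z) = 0" by (simp add: tendsto_const_iff)
  moreover have "inner Z (D - Z) = 0" using Z(2)[OF Z(1)] by (simp add: inner_commute)
  ultimately have "inner (D - Z) (D - Z) = 0" by (simp add: inner_diff_left)
  then show ?thesis using Z(1) by simp
qed

theorem proposition4p11:
  fixes \<phi> :: "real \<Rightarrow> real" and Xbar Vbar :: l2 and X V \<Psi> :: "real \<Rightarrow> l2"
  assumes phi: "comm_protocol \<phi>"
    and Xbar: "Xbar \<in> K"
    and sol: "lagrangian_solution \<phi> Xbar Vbar X"
    and stick: "sticky X"
    and V: "\<And>t. 0 \<le> t \<Longrightarrow> (X has_vector_derivative V t) (at_right t)"
    and Psi: "\<And>t. 0 \<le> t \<Longrightarrow> \<Psi> t = V t + Phi_rho \<phi> (X t)"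
  shows "(\<forall>t\<ge>0. V t \<in> H (X t) \<and> \<Psi> t \<in> H (X t))
    \<and> (\<forall>s t. 0 \<le> s \<and> s \<le> t \<longrightarrow>
         \<Psi> s - \<Psi> t \<in> subdiff_K (X t)
       \<and> \<Psi> t = metric_proj (H (X t)) (\<Psi> s)
       \<and> X t = metric_proj K (X s + (t - s) *\<^sub>R \<Psi> s - integral {s..t} (\<lambda>r. Phi_rho \<phi> (X r))))
    \<and> (\<forall>t\<ge>0.
         V t = metric_proj (H (X t)) (U_field \<phi> Xbar Vbar (X t))
       \<and> V t = metric_proj (H (X t)) (Psi \<phi> Xbar Vbar) - Phi_rho \<phi> (X t)
       \<and> \<Psi> t = metric_proj (H (X t)) (Psi \<phi> Xbar Vbar)
       \<and> X t = metric_proj K (Xbar + integral {0..t} (\<lambda>s. U_field \<phi> Xbar Vbar (X s)))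
       \<and> X t = metric_proj K (Xbar + t *\<^sub>R Psi \<phi> Xbar Vbar - integral {0..t} (\<lambda>s. Phi_rho \<phi> (X s))))"
proof -

  \<comment> \<open>Continuity of the force and membership in \<open>H (X t)\<close>\<close>
  define F where "F r = Phi_rho \<phi> (X r)" for r
  define P where "P = Psi \<phi> Xbar Vbar"
  have XK: "X t \<in> K" if "0 \<le> t" for t
    using sol that by (simp add: lagrangian_solution_def)
  have X0: "X 0 = Xbar" using sol by (simp add: lagrangian_solution_def)
  have X_cont: "continuous_on {0..} X"
    using sol by (auto simp: lagrangian_solution_def intro: abs_cont_curve_imp_continuous_on)
  have F_cont: "continuous_on {0..} F"
    unfolding F_def[abs_def]
    by (rule continuous_on_compose2[OF continuous_on_Phi_rho[OF phi] X_cont]) (auto intro: XK)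
  have F_int: "F integrable_on {0..t}" for t
    by (intro integrable_continuous_real continuous_on_subset[OF F_cont]) auto
  have U: "U_field \<phi> Xbar Vbar (X t) = P - F t" if "0 \<le> t" for t
    using U_field_eq[OF phi XK[OF that]] by (simp add: P_def F_def)
  have Psi_V: "\<Psi> t = V t + F t" if "0 \<le> t" for t
    using Psi[OF that] by (simp add: F_def)
  have const_sub: "Omega_const (X s) \<subseteq> Omega_const (X t)" if "0 \<le> s" "s \<le> t" for s t
    using stick that by (auto simp: sticky_def)
  have X_H: "X t \<in> H (X s)" if "0 \<le> s" "s \<le> t" for s t
    using K_subset_H[OF XK] H_antimono[OF const_sub[OF that]] that by auto
  have F_H: "F t \<in> H (X t)" if "0 \<le> t" for t
    unfolding F_def by (intro Phi_rho_in_H phi XK that)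
  have V_H: "V t \<in> H (X t)" if "0 \<le> t" for t
    using that by (intro right_derivative_in_closed_subspace[OF V subspace_H closed_H] X_H) auto
  have Psi_H: "\<Psi> t \<in> H (X t)" if "0 \<le> t" for t
    unfolding Psi_V[OF that] by (intro subspace_add subspace_H V_H F_H that)

  \<comment> \<open>A primitive of \<open>\<Psi> - c\<close> in the sense of right derivatives, so
    sign conditions on \<open>\<Psi> - c\<close> become monotonicity of pairings with
    \<open>G c\<close>. It is used with \<open>c = P\<close> and
    \<open>c = \<Psi> s\<close>.\<close>
  define G where "G c r = X r - r *\<^sub>R c + integral {0..r} F" for c r
  have G_der: "(G c has_vector_derivative \<Psi> t - c) (at_right t)" if "0 \<le> t" for c t
  proof -
    have "(G c has_vector_derivative V t - 1 *\<^sub>R c + F t) (at_right t)"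
      unfolding G_def[abs_def]
      by (intro has_vector_derivative_add has_vector_derivative_diff V[OF that]
          integral_has_right_derivative[OF F_cont that] has_vector_derivative_scaleR[where g = "\<lambda>_. c" and g' = 0, simplified]) auto
    then show ?thesis using Psi_V[OF that] by (simp add: algebra_simps)
  qed
  have G_cont: "continuous_on {0..} (G c)" for c
    unfolding G_def[abs_def] by (intro continuous_intros X_cont continuous_on_integral_from F_cont)

  \<comment> \<open>The differential inclusion at every time\<close>
  have P_AE: "AE t in lborel. 0 \<le> t \<longrightarrow> P - \<Psi> t \<in> subdiff_K (X t)"
  proof -
    have "AE t in lborel. 0 < t \<longrightarrow> (\<exists>D. (X has_vector_derivative D) (at t) \<and>
            - D \<in> {- U_field \<phi> Xbar Vbar (X t) + W | W. W \<in> subdiff_K (X t)})"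
      using sol by (simp add: lagrangian_solution_def)
    moreover have "AE t in lborel. t \<noteq> (0::real)" by (rule AE_lborel_singleton)
    ultimately show ?thesis
    proof eventually_elim
      case (elim t)
      show ?case
      proof
        assume "0 \<le> t"
        with elim have t: "0 < t" by simp
        then obtain D W where D: "(X has_vector_derivative D) (at t)"
          and W: "- D = - U_field \<phi> Xbar Vbar (X t) + W" "W \<in> subdiff_K (X t)"
          using elim by auto
        have "D = V t"
        proof (rule vector_derivative_unique_within[of t "{t<..}" X])
          show "(X has_vector_derivative D) (at_right t)"
            using D by (rule has_vector_derivative_at_within)
        qed (use V t in auto)
        then have "W = P - \<Psi> t"
          using W(1) U[of t] Psi_V[of t] t by (simp add: algebra_simps)
        then show "P - \<Psi> t \<in> subdiff_K (X t)" using W(2) by simp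
      qed
    qed
  qed
  text \<open>Both conditions on \<open>P - \<Psi> t\<close> are derivatives of continuous functions of time and so carry
    over from almost every \<open>t\<close> to every \<open>t\<close>.\<close>
  have P_sub: "P - \<Psi> t \<in> subdiff_K (X t)" if t: "0 \<le> t" for t
  proof -
    have "0 \<le> inner (\<Psi> t - P) Y" if Y: "Y \<in> K" for Y
    proof (rule AE_nonneg_right_derivative_imp_nonneg
        [where f = "\<lambda>r. inner (G P r) Y" and D = "\<lambda>r. inner (\<Psi> r - P) Y" and a = 0])
      show "continuous_on {0..} (\<lambda>r. inner (G P r) Y)" by (intro continuous_intros G_cont)
      show "((\<lambda>r. inner (G P r) Y) has_real_derivative inner (\<Psi> r - P) Y) (at_right r)" if "0 \<le> r" for r
        by (intro inner_has_right_derivative G_der that)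
      show "AE r in lborel. 0 \<le> r \<longrightarrow> 0 \<le> inner (\<Psi> r - P) Y"
        using P_AE by eventually_elim (use XK Y in \<open>auto simp: subdiff_K_iff inner_diff_left\<close>)
    qed fact
    moreover have "inner (\<Psi> t - P) (X t) = 0"
    proof -
      \<comment> \<open>The test element \<open>X r\<close> now moves with time, so \<open>G\<close>
        is replaced by the energy \<open>inner (X r) (X r) / 2\<close>, whose derivative is
        \<open>inner (V r) (X r)\<close>; \<open>p\<close> supplies the rest of
        \<open>inner (\<Psi> r - P) (X r)\<close>.\<close>
      define p where "p r = inner (F r - P) (X r)" for r
      have p: "continuous_on {0..} p"
        unfolding p_def[abs_def] by (intro continuous_intros F_cont X_cont)
      define f where "f r = inner (X r) (X r) / 2 + integral {0..r} p" for r
      have f_cont: "continuous_on {0..} f"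
        unfolding f_def[abs_def] by (intro continuous_intros X_cont continuous_on_integral_from p) auto
      have f_der: "(f has_real_derivative inner (\<Psi> r - P) (X r)) (at_right r)" if r: "0 \<le> r" for r
      proof -
        have "(f has_real_derivative inner (V r) (X r) + p r) (at_right r)"
          unfolding f_def[abs_def]
          by (intro DERIV_add inner_self_has_right_derivative V r
              integral_has_right_derivative[OF p r, folded has_real_derivative_iff_has_vector_derivative])
        then show ?thesis by (simp add: p_def Psi_V[OF r] inner_add_left inner_diff_left algebra_simps)
      qed
      have AE0: "AE r in lborel. 0 \<le> r \<longrightarrow> inner (\<Psi> r - P) (X r) = 0"
        using P_AE by eventually_elim (use XK in \<open>auto simp: subdiff_K_iff inner_diff_left\<close>)
      have "0 \<le> inner (\<Psi> t - P) (X t)"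
        using AE0 by (intro AE_nonneg_right_derivative_imp_nonneg[where D = "\<lambda>r. inner (\<Psi> r - P) (X r)", OF f_cont f_der _ t]) auto
      moreover have "0 \<le> - inner (\<Psi> t - P) (X t)"
      proof (rule AE_nonneg_right_derivative_imp_nonneg
          [where f = "\<lambda>r. - f r" and D = "\<lambda>r. - inner (\<Psi> r - P) (X r)" and a = 0])
        show "continuous_on {0..} (\<lambda>r. - f r)" by (intro continuous_intros f_cont)
        show "((\<lambda>r. - f r) has_real_derivative - inner (\<Psi> r - P) (X r)) (at_right r)" if "0 \<le> r" for r
          by (intro DERIV_minus f_der that)
        show "AE r in lborel. 0 \<le> r \<longrightarrow> 0 \<le> - inner (\<Psi> r - P) (X r)"
          using AE0 by eventually_elim auto
      qed fact
      ultimately show ?thesis by simp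
    qed
    ultimately show ?thesis using XK[OF t] by (simp add: subdiff_K_iff inner_diff_left)
  qed
  have Psi_sub: "\<Psi> s - \<Psi> t \<in> subdiff_K (X t)" if "0 \<le> s" "s \<le> t" for s t
    using that by (auto intro: subdiff_K_diff[OF XK XK const_sub Psi_H P_sub Psi_H P_sub])

  \<comment> \<open>The projection formulas\<close>
  have proj_H: "metric_proj (H (X t)) A = B"
    if "0 \<le> t" "B \<in> H (X t)" "A - B \<in> subdiff_K (X t)" for t A B
    using that inner_eq_0_if_subdiff_K[OF XK] by (intro metric_proj_subspaceI subspace_H) auto

  \<comment> \<open>A general \<open>c\<close> covers both formulas: \<open>c = \<Psi> s\<close>
    from time \<open>s\<close>, and \<open>c = P\<close> from time 0.\<close>
  have proj_K: "X t = metric_proj K (X s + (t - s) *\<^sub>R c - integral {s..t} F)"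
    if s: "0 \<le> s" "s \<le> t" and c: "\<And>r. s \<le> r \<Longrightarrow> r \<le> t \<Longrightarrow> c - \<Psi> r \<in> subdiff_K (X r)" for s t c
  proof -
    have cont: "continuous_on {s..t} (G c)"
      by (rule continuous_on_subset[OF G_cont]) (use s in auto)
    \<comment> \<open>\<open>Y\<close> is arbitrary because one of the test vectors is
      \<open>- X t\<close>, which need not lie in \<open>K\<close>.\<close>
    have incr: "inner (G c s) Y \<le> inner (G c t) Y"
      if "\<And>r. s \<le> r \<Longrightarrow> r \<le> t \<Longrightarrow> 0 \<le> inner (\<Psi> r - c) Y" for Y
    proof (rule AE_nonneg_right_derivative_imp_le[OF s(2), where f = "\<lambda>r. inner (G c r) Y" and D = "\<lambda>r. inner (\<Psi> r - c) Y"])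
      show "continuous_on {s..t} (\<lambda>r. inner (G c r) Y)" by (intro continuous_intros cont)
      show "((\<lambda>r. inner (G c r) Y) has_real_derivative inner (\<Psi> r - c) Y) (at_right r)"
        if "r \<in> {s..<t}" for r
        by (intro inner_has_right_derivative G_der) (use that s in auto)
    qed (use that in auto)
    have "inner (G c s) (- X t) \<le> inner (G c t) (- X t)"
    proof (rule incr)
      fix r assume r: "s \<le> r" "r \<le> t"
      then have "inner (c - \<Psi> r) (X t) = 0"
        using s by (intro inner_eq_0_if_subdiff_K[OF XK c X_H]) auto
      then show "0 \<le> inner (\<Psi> r - c) (- X t)" by (simp add: inner_diff_left)
    qed
    moreover have "inner (G c s) Z \<le> inner (G c t) Z" if Z: "Z \<in> K" for Z
    proof (rule incr)
      fix r assume r: "s \<le> r" "r \<le> t"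
      then show "0 \<le> inner (\<Psi> r - c) Z"
        using c[OF r] XK[of r] s Z by (auto simp: subdiff_K_iff inner_diff_left)
    qed
    ultimately have obtuse: "inner (G c s - G c t) (Z - X t) \<le> 0" if "Z \<in> K" for Z
      using that by (force simp: inner_diff_left inner_diff_right)
    have "integral {0..s} F + integral {s..t} F = integral {0..t} F"
      using s by (intro Henstock_Kurzweil_Integration.integral_combine F_int) auto
    then have "X s + (t - s) *\<^sub>R c - integral {s..t} F - X t = G c s - G c t"
      by (simp add: G_def algebra_simps)
    then show ?thesis
      using obtuse XK s by (intro metric_proj_eqI[symmetric]) auto
  qed

  have "V t = metric_proj (H (X t)) (U_field \<phi> Xbar Vbar (X t))
      \<and> V t = metric_proj (H (X t)) P - F t
      \<and> \<Psi> t = metric_proj (H (X t)) P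
      \<and> X t = metric_proj K (Xbar + integral {0..t} (\<lambda>s. U_field \<phi> Xbar Vbar (X s)))
      \<and> X t = metric_proj K (Xbar + t *\<^sub>R P - integral {0..t} F)" if t: "0 \<le> t" for t
  proof (intro conjI)
    \<comment> \<open>\<open>V t\<close> and \<open>\<Psi> t\<close> are projections of vectors that
      both differ by \<open>F t\<close>, so the same subdifferential element serves for the
      two.\<close>
    have "P - F t - V t \<in> subdiff_K (X t)" using P_sub[OF t] Psi_V[OF t] by (simp add: algebra_simps)
    then show "V t = metric_proj (H (X t)) (U_field \<phi> Xbar Vbar (X t))"
      using proj_H[OF t V_H[OF t]] by (simp add: U[OF t])
    show Psi_eq: "\<Psi> t = metric_proj (H (X t)) P"
      using proj_H[OF t Psi_H[OF t] P_sub[OF t]] by simp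
    then show "V t = metric_proj (H (X t)) P - F t"
      using Psi_V[OF t] by (simp add: eq_diff_eq)
    show X_eq: "X t = metric_proj K (Xbar + t *\<^sub>R P - integral {0..t} F)"
      using proj_K[of 0 t P] t P_sub X0 by simp
    have "integral {0..t} (\<lambda>s. U_field \<phi> Xbar Vbar (X s)) = integral {0..t} (\<lambda>s. P - F s)"
      by (intro Henstock_Kurzweil_Integration.integral_cong) (simp add: U)
    also have "\<dots> = t *\<^sub>R P - integral {0..t} F"
      by (subst Henstock_Kurzweil_Integration.integral_diff[OF _ F_int]) (use t in auto)
    finally show "X t = metric_proj K (Xbar + integral {0..t} (\<lambda>s. U_field \<phi> Xbar Vbar (X s)))"
      using X_eq by (simp only: add_diff_eq)
  qed
  moreover have "\<Psi> s - \<Psi> t \<in> subdiff_K (X t) \<and> \<Psi> t = metric_proj (H (X t)) (\<Psi> s)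
      \<and> X t = metric_proj K (X s + (t - s) *\<^sub>R \<Psi> s - integral {s..t} F)" if "0 \<le> s" "s \<le> t" for s t
  proof (intro conjI)
    show "\<Psi> s - \<Psi> t \<in> subdiff_K (X t)" by (rule Psi_sub[OF that])
    show "\<Psi> t = metric_proj (H (X t)) (\<Psi> s)"
      using that by (intro proj_H[OF _ Psi_H Psi_sub, symmetric]) auto
    show "X t = metric_proj K (X s + (t - s) *\<^sub>R \<Psi> s - integral {s..t} F)"
      using that by (intro proj_K Psi_sub) auto
  qed
  ultimately show ?thesis
    using V_H Psi_H unfolding P_def F_def[abs_def] by blast
qed

end
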